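(* Let $X \leq_{\mathrm T} \emptyset'$ be $1$-random. There is a promptly simple set $A$ such that for every $D \subseteq \omega$, if $\overline{\rho}(D \triangle X) < \frac14$ then $A \leq_{\mathrm T} D$. In particular, $X^{\mathfrak c}$ contains a promptly simple set, and there is a promptly simple set $A$ such that $\mathcal E(A) \leq_{\mathrm{nc}} X$.
   Context: For $B \subseteq \omega$ and $n \geq 1$ let $\rho_n(B) = |B \cap [0,n)|/n$; $\overline{\rho}(B) = \limsup_n \rho_n(B)$, and $\rho(B) = \lim_n \rho_n(B)$ when it exists. $D$ is a coarse description of $X$ if $\rho(D \triangle X) = 0$. $X^{\mathfrak c}$ is the class of all sets computable from every coarse description of $X$. $Y \leq_{\mathrm{nc}} X$ if every coarse description of $X$ computes a coarse description of $Y$. Let $I_n = [n!,(n+1)!)$, $\mathcal I(A) = \bigcup_{n \in A} I_n$, $\mathcal H(A) = \{\langle n,i\rangle : n \in A,\ i \in \omega\}$ (with $\langle\cdot,\cdot\rangle$ a computable pairing function), and $\mathcal E(A) = \mathcal I(\mathcal H(A))$. "$1$-random" means Martin-Löf random. Let $W_0,W_1,\ldots$ be an effective listing of the c.e. sets (with standard computable stage approximations $W_e[s]$). A set $A$ is promptly simple if it is c.e. and coinfinite, and there exist a computable function $f$ and a computable enumeration $A[0],A[1],\ldots$ of $A$ such that for each $e$, if $W_e$ is infinite then there are $n$ and $s$ for which $n \in W_e[s] \setminus W_e[s-1]$ and $n \in A[f(s)]$. *)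

theory Defs
  imports "HOL-Probability.Probability" "HOL-Library.Nat_Bijection"
begin

section \<open>Oracle computability\<close>

text \<open>Partial recursive functions relative to a set, in unary form: tuples of arguments are
  coded by the Cantor pairing function \<^const>\<open>prod_encode\<close>. \<open>Query\<close> is the characteristic
  function of the oracle.\<close>

datatype code =
    Zero | Succ | Proj1 | Proj2 | Query
  | Tuple code code | Comp code code | Prec code code | Mu code

text \<open>\<open>run A c x y t\<close>: with oracle \<open>A\<close>, the program \<open>c\<close> on input \<open>x\<close> halts with output \<open>y\<close> after
  exactly \<open>t\<close> evaluation steps. On input \<open>(a, m)\<close>, \<open>Mu c\<close> searches for the least \<open>n \<ge> m\<close> such that
  \<open>c (a, n) = 0\<close>; ordinary minimization starts the search at \<open>m = 0\<close>.\<close>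

inductive run :: "nat set \<Rightarrow> code \<Rightarrow> nat \<Rightarrow> nat \<Rightarrow> nat \<Rightarrow> bool" for A :: "nat set" where
  run_Zero: "run A Zero x 0 1"
| run_Succ: "run A Succ x (Suc x) 1"
| run_Proj1: "run A Proj1 x (fst (prod_decode x)) 1"
| run_Proj2: "run A Proj2 x (snd (prod_decode x)) 1"
| run_Query: "run A Query x (of_bool (x \<in> A)) 1"
| run_Tuple: "run A c x y t \<Longrightarrow> run A d x z u \<Longrightarrow>
    run A (Tuple c d) x (prod_encode (y, z)) (Suc (t + u))"
| run_Comp: "run A d x y t \<Longrightarrow> run A c y z u \<Longrightarrow> run A (Comp c d) x z (Suc (t + u))"
| run_Prec_0: "run A c a y t \<Longrightarrow> run A (Prec c d) (prod_encode (a, 0)) y (Suc t)"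
| run_Prec_Suc: "run A (Prec c d) (prod_encode (a, n)) y t \<Longrightarrow>
    run A d (prod_encode (a, prod_encode (n, y))) z u \<Longrightarrow>
    run A (Prec c d) (prod_encode (a, Suc n)) z (Suc (t + u))"
| run_Mu_found: "run A c (prod_encode (a, m)) 0 t \<Longrightarrow>
    run A (Mu c) (prod_encode (a, m)) m (Suc t)"
| run_Mu_next: "run A c (prod_encode (a, m)) (Suc y) t \<Longrightarrow>
    run A (Mu c) (prod_encode (a, Suc m)) z u \<Longrightarrow>
    run A (Mu c) (prod_encode (a, m)) z (Suc (t + u))"

inductive_cases run_ZeroE: "run A Zero x y t"
  and run_SuccE: "run A Succ x y t"
  and run_Proj1E: "run A Proj1 x y t"
  and run_Proj2E: "run A Proj2 x y t"
  and run_QueryE: "run A Query x y t"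
  and run_TupleE: "run A (Tuple c d) x y t"
  and run_CompE: "run A (Comp c d) x y t"
  and run_PrecE: "run A (Prec c d) x y t"
  and run_MuE: "run A (Mu c) x y t"

lemma run_deterministic:
  "run A c x y t \<Longrightarrow> run A c x y' t' \<Longrightarrow> y = y' \<and> t = t'"
proof (induction arbitrary: y' t' rule: run.induct)
  case run_Zero then show ?case by (auto elim: run_ZeroE)
next
  case run_Succ then show ?case by (auto elim: run_SuccE)
next
  case run_Proj1 then show ?case by (auto elim: run_Proj1E)
next
  case run_Proj2 then show ?case by (auto elim: run_Proj2E)
next
  case run_Query then show ?case by (auto elim: run_QueryE)
next
  case (run_Tuple c x y t d z u)
  from run_Tuple.prems run_Tuple.IH show ?case by (metis run_TupleE)
next
  case (run_Comp d x y t c z u)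
  from run_Comp.prems run_Comp.IH show ?case by (metis run_CompE)
next
  case (run_Prec_0 c a y t d)
  from run_Prec_0.prems obtain s where "run A c a y' s" "t' = Suc s"
    by (rule run_PrecE) auto
  then show ?case using run_Prec_0.IH by simp
next
  case (run_Prec_Suc c d a n y t z u)
  from run_Prec_Suc.prems obtain v p q where "run A (Prec c d) (prod_encode (a, n)) v p"
      "run A d (prod_encode (a, prod_encode (n, v))) y' q" "t' = Suc (p + q)"
    by (rule run_PrecE) auto
  then show ?case using run_Prec_Suc.IH by metis
next
  case (run_Mu_found c a m t)
  from run_Mu_found.prems have
    "(\<exists>s. y' = m \<and> t' = Suc s \<and> run A c (prod_encode (a, m)) 0 s) \<or>
     (\<exists>v p. run A c (prod_encode (a, m)) (Suc v) p)"
    by (rule run_MuE) auto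
  then show ?case using run_Mu_found.IH by fastforce
next
  case (run_Mu_next c a m y t z u)
  from run_Mu_next.prems have
    "(\<exists>s. run A c (prod_encode (a, m)) 0 s) \<or>
     (\<exists>v p q. t' = Suc (p + q) \<and> run A c (prod_encode (a, m)) (Suc v) p \<and>
        run A (Mu c) (prod_encode (a, Suc m)) y' q)"
    by (rule run_MuE) auto
  then show ?case using run_Mu_next.IH by fastforce
qed

definition computable_in :: "nat set \<Rightarrow> (nat \<Rightarrow> nat) \<Rightarrow> bool" where
  "computable_in A f \<longleftrightarrow> (\<exists>c. \<forall>x. \<exists>t. run A c x (f x) t)"

abbreviation computable :: "(nat \<Rightarrow> nat) \<Rightarrow> bool" where
  "computable \<equiv> computable_in {}"

definition turing_le :: "nat set \<Rightarrow> nat set \<Rightarrow> bool" (infix "\<le>\<^sub>T" 50) where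
  "B \<le>\<^sub>T A \<longleftrightarrow> computable_in A (\<lambda>x. of_bool (x \<in> B))"


section \<open>Computably enumerable sets\<close>

primrec code_num :: "code \<Rightarrow> nat" where
  "code_num Zero = 0"
| "code_num Succ = 1"
| "code_num Proj1 = 2"
| "code_num Proj2 = 3"
| "code_num Query = 4"
| "code_num (Tuple c d) = 5 + 4 * prod_encode (code_num c, code_num d)"
| "code_num (Comp c d) = 6 + 4 * prod_encode (code_num c, code_num d)"
| "code_num (Prec c d) = 7 + 4 * prod_encode (code_num c, code_num d)"
| "code_num (Mu c) = 8 + 4 * code_num c"

lemma surj_code_num: "\<exists>c. code_num c = e"
proof (induction e rule: less_induct)
  case (less e)
  show ?case
  proof (cases "e < 5")
    case True
    then have "e = 0 \<or> e = 1 \<or> e = 2 \<or> e = 3 \<or> e = 4" by linarith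
    then show ?thesis using code_num.simps(1-5) by metis
  next
    case False
    define m where "m = (e - 5) div 4"
    have e: "e = 5 + 4 * m \<or> e = 6 + 4 * m \<or> e = 7 + 4 * m \<or> e = 8 + 4 * m"
      using False unfolding m_def by presburger
    then have me: "m < e" by linarith
    obtain i j where ij: "m = prod_encode (i, j)" by (metis prod_decode_inverse surj_pair)
    then have "i < e" "j < e"
      using me le_prod_encode_1[of i j] le_prod_encode_2[of j i] by linarith+
    then obtain c d where "code_num c = i" "code_num d = j" using less by blast
    moreover obtain b where "code_num b = m" using less me by blast
    ultimately show ?thesis using e ij code_num.simps(6-9) by metis
  qed
qed

lemma inj_code_num: "code_num c = code_num d \<Longrightarrow> c = d"
proof (induction c arbitrary: d)
  case (Tuple c1 c2)
  have "code_num d mod 4 = 1" "5 \<le> code_num d"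
    unfolding Tuple.prems[symmetric] by simp_all
  then show ?case using Tuple by (cases d) simp_all
next
  case (Comp c1 c2)
  have "code_num d mod 4 = 2" "5 \<le> code_num d"
    unfolding Comp.prems[symmetric] by simp_all
  then show ?case using Comp by (cases d) simp_all
next
  case (Prec c1 c2)
  have "code_num d mod 4 = 3" "5 \<le> code_num d"
    unfolding Prec.prems[symmetric] by simp_all
  then show ?case using Prec by (cases d) simp_all
next
  case (Mu c)
  have "code_num d mod 4 = 0" "5 \<le> code_num d"
    unfolding Mu.prems[symmetric] by simp_all
  then show ?case using Mu by (cases d) simp_all
qed (case_tac d; simp)+

definition W :: "nat \<Rightarrow> nat set" where
  "W e = {n. \<exists>c y t. code_num c = e \<and> run {} c n y t}"

text \<open>The usual restriction \<open>n < s\<close> keeps the stages finite and makes stage \<open>0\<close> empty.\<close>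

definition W_stage :: "nat \<Rightarrow> nat \<Rightarrow> nat set" where
  "W_stage e s = {n. n < s \<and> (\<exists>c y t. code_num c = e \<and> t \<le> s \<and> run {} c n y t)}"

lemma W_stage_0: "W_stage e 0 = {}"
  by (simp add: W_stage_def)

lemma mono_W_stage: "mono (W_stage e)"
proof (rule monoI, rule subsetI)
  fix s s' n :: nat
  assume "s \<le> s'" and "n \<in> W_stage e s"
  then show "n \<in> W_stage e s'"
    unfolding W_stage_def using order.trans order.strict_trans2 by blast
qed

lemma UN_W_stage: "(\<Union>s. W_stage e s) = W e"
proof
  show "W e \<subseteq> (\<Union>s. W_stage e s)"
  proof
    fix n assume "n \<in> W e"
    then obtain c y t where "code_num c = e" "run {} c n y t" by (auto simp: W_def)
    then have "n \<in> W_stage e (max (Suc n) t)" by (auto simp: W_stage_def less_max_iff_disj le_max_iff_disj)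
    then show "n \<in> (\<Union>s. W_stage e s)" by blast
  qed
qed (auto simp: W_def W_stage_def)

definition ce :: "nat set \<Rightarrow> bool" where
  "ce A \<longleftrightarrow> (\<exists>e. A = W e)"

definition zero_jump :: "nat set" where
  "zero_jump = {e. e \<in> W e}"

text \<open>A computable enumeration is an increasing sequence of finite sets whose canonical indices
  are given by a computable function.\<close>

definition computable_enumeration :: "(nat \<Rightarrow> nat set) \<Rightarrow> nat set \<Rightarrow> bool" where
  "computable_enumeration As A \<longleftrightarrow>
     (\<forall>s. finite (As s)) \<and> computable (\<lambda>s. set_encode (As s)) \<and> mono As \<and> (\<Union>s. As s) = A"

text \<open>Since \<^term>\<open>W_stage e 0 = {}\<close>, the truncated \<open>s - 1\<close> is harmless at \<open>s = 0\<close>.\<close>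

definition promptly_simple :: "nat set \<Rightarrow> bool" where
  "promptly_simple A \<longleftrightarrow> ce A \<and> infinite (- A) \<and>
     (\<exists>f As. computable f \<and> computable_enumeration As A \<and>
       (\<forall>e. infinite (W e) \<longrightarrow>
         (\<exists>n s. n \<in> W_stage e s - W_stage e (s - 1) \<and> n \<in> As (f s))))"


section \<open>Martin-Loef randomness\<close>

text \<open>The uniform measure on Cantor space.\<close>

definition cantor_measure :: "(nat \<Rightarrow> bool) measure" where
  "cantor_measure = PiM UNIV (\<lambda>_. uniform_count_measure (UNIV :: bool set))"

definition cylinder :: "bool list \<Rightarrow> (nat \<Rightarrow> bool) set" where
  "cylinder \<sigma> = {Z. \<forall>i < length \<sigma>. Z i = \<sigma> ! i}"

definition string_num :: "bool list \<Rightarrow> nat" where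
  "string_num \<sigma> = list_encode (map of_bool \<sigma>)"

text \<open>A uniformly c.e. sequence of open classes is given by a single c.e. set of pairs
  consisting of an index and a (coded) string.\<close>

definition uniformly_ce_open :: "(nat \<Rightarrow> (nat \<Rightarrow> bool) set) \<Rightarrow> bool" where
  "uniformly_ce_open U \<longleftrightarrow>
     (\<exists>S. ce S \<and> (\<forall>n. U n = (\<Union>\<sigma> \<in> {\<sigma>. prod_encode (n, string_num \<sigma>) \<in> S}. cylinder \<sigma>)))"

definition ml_test :: "(nat \<Rightarrow> (nat \<Rightarrow> bool) set) \<Rightarrow> bool" where
  "ml_test U \<longleftrightarrow> uniformly_ce_open U \<and> (\<forall>n. measure cantor_measure (U n) \<le> (1 / 2) ^ n)"

definition ml_random :: "nat set \<Rightarrow> bool" where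
  "ml_random X \<longleftrightarrow> (\<forall>U. ml_test U \<longrightarrow> (\<lambda>n. n \<in> X) \<notin> (\<Inter>n. U n))"


section \<open>Density and coarse computability\<close>

definition partial_density :: "nat set \<Rightarrow> nat \<Rightarrow> real" where
  "partial_density B n = real (card (B \<inter> {0..<n})) / real n"

definition upper_density :: "nat set \<Rightarrow> ereal" where
  "upper_density B = limsup (\<lambda>n. ereal (partial_density B n))"

definition has_density :: "nat set \<Rightarrow> real \<Rightarrow> bool" where
  "has_density B r \<longleftrightarrow> partial_density B \<longlonglongrightarrow> r"

definition coarse_description :: "nat set \<Rightarrow> nat set \<Rightarrow> bool" where
  "coarse_description D X \<longleftrightarrow> has_density (sym_diff D X) 0"

definition coarse_class :: "nat set \<Rightarrow> nat set set" where
  "coarse_class X = {Y. \<forall>D. coarse_description D X \<longrightarrow> Y \<le>\<^sub>T D}"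

definition nc_le :: "nat set \<Rightarrow> nat set \<Rightarrow> bool" (infix "\<le>\<^sub>n\<^sub>c" 50) where
  "Y \<le>\<^sub>n\<^sub>c X \<longleftrightarrow>
     (\<forall>D. coarse_description D X \<longrightarrow> (\<exists>E. coarse_description E Y \<and> E \<le>\<^sub>T D))"

definition block :: "nat \<Rightarrow> nat set" where
  "block n = {fact n..<fact (n + 1)}"

definition I_op :: "nat set \<Rightarrow> nat set" where
  "I_op A = (\<Union>n\<in>A. block n)"

definition H_op :: "nat set \<Rightarrow> nat set" where
  "H_op A = {prod_encode (n, i) | n i. n \<in> A}"

definition E_op :: "nat set \<Rightarrow> nat set" where
  "E_op A = I_op (H_op A)"

end

theory Submission
  imports Defs
begin

text \<open>Let \<open>G s\<close> be a computable approximation to the \<open>1\<close>-random set \<open>X\<close>, given by the limit lemma.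
  The requirement \<open>e\<close> enumerates a number \<open>n\<close> that enters \<open>W e\<close> at a stage \<open>s\<close>, provided that
  \<open>n \<ge> 2 e\<close> and that \<open>G\<close> did not change below the length \<open>l = 2 \<cdot> 8 ^ e\<close> between the stages \<open>n\<close> and \<open>s\<close>.
  It then puts into a Martin-Loef test all sequences that differ from \<open>G s\<close> in fewer than
  \<open>l / 2 - 4 ^ e\<close> of the first \<open>l\<close> places; by Hoeffding's inequality this class has measure at most
  \<open>2 ^ - e\<close>. If \<open>D\<close> differs from \<open>X\<close> with upper density less than \<open>1 / 4\<close>, then \<open>D\<close> can find a stage
  \<open>s \<ge> n\<close> at which it differs from \<open>G s\<close> in fewer than a quarter of the places, up to the same
  margin, for all relevant \<open>e \<le> n\<close>. If \<open>n\<close> is enumerated after that stage, then the triangle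
  inequality puts \<open>X\<close> into the test class of the requirement responsible, which happens only
  finitely often.\<close>

section \<open>Closure properties of the computable functions\<close>

abbreviation pi1 :: "nat \<Rightarrow> nat" where "pi1 z \<equiv> fst (prod_decode z)"
abbreviation pi2 :: "nat \<Rightarrow> nat" where "pi2 z \<equiv> snd (prod_decode z)"

named_theorems comp_intros

text \<open>There is no identity program; pairing the two projections gives one, because every
  number is a coded pair.\<close>

lemma comp_id: "computable_in A (\<lambda>x. x)"
proof -
  have "run A (Tuple Proj1 Proj2) x x (Suc (1 + 1))" for x
    using run_Tuple[OF run_Proj1 run_Proj2, of A x] by simp
  then show ?thesis unfolding computable_in_def by blast
qed

lemma comp_comp: "computable_in A (\<lambda>x. f (g x))" if "computable_in A f" "computable_in A g"
  using that unfolding computable_in_def by (meson run_Comp)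

lemma comp_const: "computable_in A (\<lambda>x. n)"
proof (induction n)
  case 0
  show ?case unfolding computable_in_def using run_Zero by blast
next
  case (Suc n)
  have "computable_in A Suc" unfolding computable_in_def using run_Succ by blast
  then show ?case using Suc by (rule comp_comp)
qed

lemma comp_Suc: "computable_in A (\<lambda>x. Suc (f x))" if "computable_in A f"
proof -
  have "computable_in A Suc" unfolding computable_in_def using run_Succ by blast
  then show ?thesis using that by (rule comp_comp)
qed

lemma comp_pi1: "computable_in A (\<lambda>x. pi1 (f x))" if "computable_in A f"
proof -
  have "computable_in A pi1" unfolding computable_in_def using run_Proj1 by blast
  then show ?thesis using that by (rule comp_comp)
qed

lemma comp_pi2: "computable_in A (\<lambda>x. pi2 (f x))" if "computable_in A f"
proof -
  have "computable_in A pi2" unfolding computable_in_def using run_Proj2 by blast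
  then show ?thesis using that by (rule comp_comp)
qed

lemma comp_query: "computable_in A (\<lambda>x. of_bool (f x \<in> A))" if "computable_in A f"
proof -
  have "computable_in A (\<lambda>x. of_bool (x \<in> A))" unfolding computable_in_def using run_Query by blast
  then show ?thesis using that by (rule comp_comp)
qed

lemma comp_pair: "computable_in A (\<lambda>x. prod_encode (f x, g x))"
  if "computable_in A f" "computable_in A g"
  using that unfolding computable_in_def by (meson run_Tuple)

text \<open>Reduces a binary function with arbitrary computable arguments to its uncurried form on
  coded pairs.\<close>

lemma comp_comp2: "computable_in A (\<lambda>x. F (f x) (g x))"
  if "computable_in A (\<lambda>z. F (pi1 z) (pi2 z))" "computable_in A f" "computable_in A g"
  using comp_comp[OF that(1) comp_pair[OF that(2,3)]] by simp

lemma comp_comp3: "computable_in A (\<lambda>x. F (f x) (g x) (h x))"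
  if "computable_in A (\<lambda>z. F (pi1 z) (pi1 (pi2 z)) (pi2 (pi2 z)))"
     "computable_in A f" "computable_in A g" "computable_in A h"
  using comp_comp[OF that(1) comp_pair[OF that(2) comp_pair[OF that(3,4)]]] by simp

lemma comp_Let: "computable_in A (\<lambda>x. Let (f x) (g x))"
  if "computable_in A f" "computable_in A (\<lambda>z. g (pi1 z) (pi2 z))"
  unfolding Let_def using that(2) comp_id that(1) by (rule comp_comp2)

text \<open>\<open>Prec\<close> carries its parameter unchanged through the recursion, so both the
  base value and the step may depend on \<open>x\<close>.\<close>

lemma comp_rec: "computable_in A (\<lambda>x. rec_nat (f x) (\<lambda>n y. g x n y) (k x))"
  if f: "computable_in A f"
    and g: "computable_in A (\<lambda>z. g (pi1 z) (pi1 (pi2 z)) (pi2 (pi2 z)))"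
    and k: "computable_in A k"
proof -
  obtain c d where c: "\<forall>x. \<exists>t. run A c x (f x) t"
    and d: "\<forall>z. \<exists>t. run A d z (g (pi1 z) (pi1 (pi2 z)) (pi2 (pi2 z))) t"
    using f g unfolding computable_in_def by blast
  have "\<exists>t. run A (Prec c d) (prod_encode (a, n)) (rec_nat (f a) (\<lambda>n y. g a n y) n) t" for a n
  proof (induction n)
    case 0
    then show ?case using c run_Prec_0 by fastforce
  next
    case (Suc n)
    then obtain t where t: "run A (Prec c d) (prod_encode (a, n)) (rec_nat (f a) (\<lambda>n y. g a n y) n) t" ..
    show ?case
      using run_Prec_Suc[OF t] d[rule_format, of "prod_encode (a, prod_encode (n, rec_nat (f a) (\<lambda>n y. g a n y) n))"]
      by auto
  qed
  then have "computable_in A (\<lambda>z. rec_nat (f (pi1 z)) (\<lambda>n y. g (pi1 z) n y) (pi2 z))"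
    unfolding computable_in_def by (metis prod.collapse prod_decode_inverse)
  then show ?thesis by (rule comp_comp2[where F = "\<lambda>x m. rec_nat (f x) (g x) m", OF _ comp_id k])
qed

text \<open>Induction descends from the zero \<open>k\<close> to the starting point
  \<open>m\<close>, adding one \<open>run_Mu_next\<close> per position; the values passed on the way
  are defined and nonzero.\<close>

lemma run_Mu_least:
  assumes "\<forall>n. \<exists>t. run A c (prod_encode (a, n)) (f n) t" and "f k = 0" and "\<forall>i. m \<le> i \<and> i < k \<longrightarrow> f i \<noteq> 0"
    and "m \<le> k"
  shows "\<exists>t. run A (Mu c) (prod_encode (a, m)) k t"
  using assms(4,3)
proof (induction m rule: inc_induct)
  case base
  then show ?case using run_Mu_found assms(1,2) by metis
next
  case (step n)
  then obtain t where "run A (Mu c) (prod_encode (a, Suc n)) k t" by auto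
  moreover obtain t' where "run A c (prod_encode (a, n)) (f n) t'" using assms(1) by blast
  moreover obtain y where "f n = Suc y" using step.prems step.hyps by (metis not0_implies_Suc order_refl)
  ultimately show ?case using run_Mu_next by metis
qed

text \<open>Supplies the starting point \<open>0\<close> that turns the search of \<open>Mu\<close>
  into ordinary minimization.\<close>

lemma run_pair_zero: "\<exists>t. run A (Tuple (Tuple Proj1 Proj2) Zero) x (prod_encode (x, 0)) t"
  using run_Tuple[OF run_Tuple[OF run_Proj1 run_Proj2] run_Zero, of A x] by auto

text \<open>The truth value serves as the depth of a recursion: depth 0 returns the base
  \<open>g x\<close>, depth 1 overwrites it by \<open>f x\<close>.\<close>

lemma comp_if: "computable_in A (\<lambda>x. if P x then f x else g x)"
  if "computable_in A (\<lambda>x. of_bool (P x))" "computable_in A f" "computable_in A g"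
proof -
  have "computable_in A (\<lambda>x. rec_nat (g x) (\<lambda>_ _. f x) (of_bool (P x)))"
    using that(3) comp_comp[OF that(2) comp_pi1[OF comp_id]] that(1) by (rule comp_rec)
  moreover have "(\<lambda>x. rec_nat (g x) (\<lambda>_ _. f x) (of_bool (P x))) = (\<lambda>x. if P x then f x else g x)" by auto
  ultimately show ?thesis by simp
qed

lemma comp_of_nat_zero: "computable_in A (\<lambda>x. of_bool (f x = (0::nat)))" if "computable_in A f"
proof -
  have "(of_bool (n = 0) :: nat) = rec_nat 1 (\<lambda>_ _. 0) n" for n :: nat by (cases n) auto
  then show ?thesis by (simp only:) (intro comp_rec comp_const that)
qed

lemma comp_not: "computable_in A (\<lambda>x. of_bool (\<not> P x))" if "computable_in A (\<lambda>x. of_bool (P x))"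
  using comp_of_nat_zero[OF that] by simp

lemma comp_conj: "computable_in A (\<lambda>x. of_bool (P x \<and> Q x))"
  if "computable_in A (\<lambda>x. of_bool (P x))" "computable_in A (\<lambda>x. of_bool (Q x))"
proof -
  have "(\<lambda>x. of_bool (P x \<and> Q x)) = (\<lambda>x. if P x then of_bool (Q x) else (0::nat))" by auto
  then show ?thesis using comp_if[OF that comp_const[of A 0]] by simp
qed

lemma comp_disj: "computable_in A (\<lambda>x. of_bool (P x \<or> Q x))"
  if "computable_in A (\<lambda>x. of_bool (P x))" "computable_in A (\<lambda>x. of_bool (Q x))"
  using comp_not[OF comp_conj[OF comp_not[OF that(1)] comp_not[OF that(2)]]] by simp

lemma comp_imp: "computable_in A (\<lambda>x. of_bool (P x \<longrightarrow> Q x))"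
  if "computable_in A (\<lambda>x. of_bool (P x))" "computable_in A (\<lambda>x. of_bool (Q x))"
  unfolding imp_conv_disj by (intro comp_disj comp_not that)

lemma comp_iff: "computable_in A (\<lambda>x. of_bool (P x = Q x))"
  if "computable_in A (\<lambda>x. of_bool (P x))" "computable_in A (\<lambda>x. of_bool (Q x))"
  unfolding iff_conv_conj_imp by (intro comp_conj comp_imp that)

lemma comp_add: "computable_in A (\<lambda>x. f x + g x)" if "computable_in A f" "computable_in A g"
proof -
  have "m + n = rec_nat m (\<lambda>_ y. Suc y) n" for m n :: nat by (induction n) auto
  then show ?thesis by (simp only:) (intro comp_rec comp_Suc comp_pi2 comp_id that)
qed

lemma comp_mult: "computable_in A (\<lambda>x. f x * g x)" if "computable_in A f" "computable_in A g"
proof -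
  have "m * n = rec_nat 0 (\<lambda>_ y. y + m) n" for m n :: nat by (induction n) auto
  then show ?thesis
    by (simp only:) (intro comp_rec comp_const comp_add comp_pi2 comp_id that comp_comp[OF that(1) comp_pi1])
qed

lemma comp_power: "computable_in A (\<lambda>x. f x ^ g x)" if "computable_in A f" "computable_in A g"
proof -
  have "m ^ n = rec_nat 1 (\<lambda>_ y. y * m) n" for m n :: nat by (induction n) auto
  then show ?thesis
    by (simp only:) (intro comp_rec comp_const comp_mult comp_pi2 comp_id that comp_comp[OF that(1) comp_pi1])
qed

lemma comp_fact: "computable_in A (\<lambda>x. fact (f x))" if "computable_in A f"
proof -
  have "fact n = rec_nat 1 (\<lambda>k y. Suc k * y) n" for n :: nat by (induction n) auto
  then show ?thesis
    by (simp only:) (intro comp_rec comp_const comp_mult comp_Suc comp_pi1 comp_pi2 comp_id that)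
qed

lemma comp_pred: "computable_in A (\<lambda>x. f x - 1)" if "computable_in A f"
proof -
  have "n - 1 = rec_nat 0 (\<lambda>k _. k) n" for n :: nat by (cases n) auto
  then show ?thesis by (simp only:) (intro comp_rec comp_const comp_pi1 comp_pi2 comp_id that)
qed

lemma comp_diff: "computable_in A (\<lambda>x. f x - g x)" if "computable_in A f" "computable_in A g"
proof -
  have "rec_nat m (\<lambda>_ y. y - 1) n = m - n" for m n :: nat by (induction n) auto
  moreover have "computable_in A (\<lambda>x. rec_nat (f x) (\<lambda>_ y. y - 1) (g x))"
    by (intro comp_rec comp_pred comp_pi2 comp_id that)
  ultimately show ?thesis by simp
qed

lemma comp_le: "computable_in A (\<lambda>x. of_bool (f x \<le> g x))"
  if "computable_in A f" "computable_in A g" for f g :: "nat \<Rightarrow> nat"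
  using comp_of_nat_zero[OF comp_diff[OF that]] by simp

lemma comp_less: "computable_in A (\<lambda>x. of_bool (f x < g x))"
  if "computable_in A f" "computable_in A g" for f g :: "nat \<Rightarrow> nat"
  using comp_le[OF comp_Suc[OF that(1)] that(2)] by (simp add: Suc_le_eq)

lemma comp_eq: "computable_in A (\<lambda>x. of_bool (f x = g x))"
  if "computable_in A f" "computable_in A g" for f g :: "nat \<Rightarrow> nat"
  using comp_conj[OF comp_le[OF that] comp_le[OF that(2,1)]] by (simp add: order_eq_iff[symmetric])

text \<open>\<open>Mu\<close> looks for a zero, so the negated predicate is what it runs on; a
  witness for every \<open>x\<close> makes the search total.\<close>

lemma comp_Least: "computable_in A (\<lambda>x. LEAST n. P x n)"
  if P: "computable_in A (\<lambda>z. of_bool (P (pi1 z) (pi2 z)))" and ex: "\<And>x. \<exists>n. P x n"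
proof -
  obtain c where c: "\<forall>z. \<exists>t. run A c z (of_bool (\<not> P (pi1 z) (pi2 z))) t"
    using comp_not[OF P] unfolding computable_in_def by blast
  have "\<exists>t. run A (Mu c) (prod_encode (x, 0)) (LEAST n. P x n) t" for x
    by (rule run_Mu_least[where f = "\<lambda>n. of_bool (\<not> P x n)"])
      (use c[rule_format, of "prod_encode (x, _)"] LeastI_ex[OF ex] not_less_Least in auto)
  then show ?thesis
    unfolding computable_in_def using run_pair_zero run_Comp by meson
qed

lemma comp_sum: "computable_in A (\<lambda>x. \<Sum>i<k x. f x i)"
  if f: "computable_in A (\<lambda>z. f (pi1 z) (pi2 z))" and k: "computable_in A k"
  for f :: "nat \<Rightarrow> nat \<Rightarrow> nat"
proof -
  have "(\<Sum>i<n. f x i) = rec_nat 0 (\<lambda>i y. y + f x i) n" for x n by (induction n) auto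
  then show ?thesis
    by (simp only:) (intro comp_rec comp_const comp_add comp_pi1 comp_pi2 comp_id k comp_comp2[OF f])
qed

lemma comp_all: "computable_in A (\<lambda>x. of_bool (\<forall>i<k x. P x i))"
  if P: "computable_in A (\<lambda>z. of_bool (P (pi1 z) (pi2 z)))" and k: "computable_in A k"
proof -
  have "of_bool (\<forall>i<k x. P x i) = (of_bool ((\<Sum>i<k x. of_bool (\<not> P x i)) = (0::nat)) :: nat)" for x
    by auto
  then show ?thesis by (simp only:) (intro comp_of_nat_zero comp_sum comp_not P k)
qed

lemma comp_ex: "computable_in A (\<lambda>x. of_bool (\<exists>i<k x. P x i))"
  if P: "computable_in A (\<lambda>z. of_bool (P (pi1 z) (pi2 z)))" and k: "computable_in A k"
  using comp_not[OF comp_all[OF comp_not[OF P] k]] by simp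

text \<open>The quotient is found by searching for the first multiple of \<open>n\<close> that
  exceeds the dividend; for \<open>n = 0\<close> division has the constant value
  \<open>0\<close>.\<close>

lemma comp_div: "computable_in A (\<lambda>x. f x div n)" if "computable_in A f" for n :: nat
proof (cases "n = 0")
  case False
  then have "m div n = (LEAST q. m < Suc q * n)" for m
    by (intro Least_equality[symmetric])
      (simp_all add: div_less_iff_less_mult[symmetric] less_Suc_eq_le del: mult_Suc)
  moreover have "\<exists>q. m < Suc q * n" for m using False by (intro exI[of _ m]) (cases n, auto)
  ultimately show ?thesis
    by (simp only:) (intro comp_Least comp_less comp_mult comp_Suc comp_pi2 comp_const comp_id comp_comp[OF that comp_pi1])
qed (simp add: comp_const)

lemma comp_mod: "computable_in A (\<lambda>x. f x mod n)" if "computable_in A f" for n :: nat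
  unfolding minus_div_mult_eq_mod[symmetric] by (intro comp_diff comp_mult comp_div that comp_const)

lemma comp_funpow: "computable_in A (\<lambda>x. (g ^^ k x) (f x))"
  if g: "computable_in A g" and f: "computable_in A f" and k: "computable_in A k" for g :: "nat \<Rightarrow> nat"
proof -
  have "(g ^^ n) m = rec_nat m (\<lambda>_ y. g y) n" for m n by (induction n) auto
  then show ?thesis by (simp only:) (intro comp_rec f k comp_comp[OF g] comp_pi2 comp_id)
qed

lemmas [comp_intros] = comp_const comp_Suc comp_pi1 comp_pi2 comp_query comp_pair comp_Let comp_rec comp_if
  comp_not comp_conj comp_disj comp_imp comp_add comp_mult comp_power comp_fact comp_diff
  comp_le comp_less comp_iff comp_eq comp_sum comp_all comp_ex comp_div comp_mod comp_id

lemma comp_mem_turing: "computable_in D (\<lambda>x. of_bool (f x \<in> B))" if "B \<le>\<^sub>T D" "computable_in D f"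
  using comp_comp[OF that(1)[unfolded turing_le_def] that(2)] .

lemma comp_finite: "computable_in A (\<lambda>x. of_bool (x \<in> F))" if "finite F"
  using that
proof induction
  case empty
  then show ?case by (simp add: comp_const)
next
  case (insert n F)
  then show ?case unfolding insert_iff by (intro comp_disj comp_eq comp_id comp_const)
qed

text \<open>Finite sets are computable, so finitely many wrong answers can be patched. This permits
  the decoding of the constructed set to ignore finitely many requirements.\<close>

lemma turing_le_finite_diff:
  assumes "finite (sym_diff B C)" "C \<le>\<^sub>T D"
  shows "B \<le>\<^sub>T D"
proof -
  have "finite (C - B)" "finite (B - C)" using assms(1) by auto
  then have "computable_in D (\<lambda>x. of_bool (x \<in> C \<and> x \<notin> C - B \<or> x \<in> B - C))"
    using comp_finite assms(2) unfolding turing_le_def by (intro comp_disj comp_conj comp_not) (simp_all del: Diff_iff)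
  moreover have "x \<in> C \<and> x \<notin> C - B \<or> x \<in> B - C \<longleftrightarrow> x \<in> B" for x by blast
  ultimately show ?thesis unfolding turing_le_def by (simp only:)
qed

text \<open>Unbounded search for a witness halts exactly when one exists, so the projection is the
  domain of a search program.\<close>

lemma ce_projection:
  assumes "computable_in {} (\<lambda>z. of_bool (R (pi1 z) (pi2 z)))"
  shows "ce {x. \<exists>y. R x y}"
proof -
  obtain c where c: "\<forall>z. \<exists>t. run {} c z (of_bool (\<not> R (pi1 z) (pi2 z))) t"
    using comp_not[OF assms] unfolding computable_in_def by blast
  let ?c = "Comp (Mu c) (Tuple (Tuple Proj1 Proj2) Zero)"
  \<comment> \<open>Rule induction follows a halting search to the position where it stopped. The
    starting point \<open>m\<close> stays arbitrary because each unsuccessful test moves it.\<close>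
  have "\<exists>n. R x n" if "run {} d z y t" "d = Mu c" "z = prod_encode (x, m)" for x z m y t d
    using that
  proof (induction arbitrary: m rule: run.induct)
    case (run_Mu_found c' a n t)
    then show ?case
      using c[rule_format, of "prod_encode (x, m)"] by (fastforce dest: run_deterministic)
  qed auto
  moreover have "\<exists>y t. run {} ?c x y t" if "R x n" for x n
  proof -
    have "\<exists>t. run {} (Mu c) (prod_encode (x, 0)) (LEAST n. R x n) t"
      by (rule run_Mu_least[where f = "\<lambda>n. of_bool (\<not> R x n)"])
        (use c[rule_format, of "prod_encode (x, _)"] LeastI[of "R x", OF that] not_less_Least in auto)
    then show ?thesis using run_pair_zero run_Comp by meson
  qed
  moreover have "\<exists>y t. run {} (Mu c) (prod_encode (x, 0)) y t" if "run {} ?c x y t" for x y t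
    using that run_pair_zero[of "{}" x] by (elim run_CompE) (metis run_deterministic)
  ultimately have "(\<exists>y. R x y) \<longleftrightarrow> (\<exists>y t. run {} ?c x y t)" for x by blast
  then have "{x. \<exists>y. R x y} = W (code_num ?c)"
    unfolding W_def using inj_code_num by blast
  then show ?thesis unfolding ce_def by blast
qed

section \<open>A universal machine\<close>

text \<open>A configuration holds the number of evaluation steps made so far, the current value and a
  stack of tasks. Tag 0 evaluates a program at the current value, tags 1 and 2 are the two
  remaining halves of \<^const>\<open>Tuple\<close>, and tags 3 and 4 continue \<^const>\<open>Prec\<close> and \<^const>\<open>Mu\<close>.\<close>

definition push :: "nat \<Rightarrow> nat \<Rightarrow> nat \<Rightarrow> nat" where
  "push tag p K = Suc (prod_encode (prod_encode (tag, p), K))"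

definition config :: "nat \<Rightarrow> nat \<Rightarrow> nat \<Rightarrow> nat" where
  "config n v K = prod_encode (n, prod_encode (v, K))"

text \<open>The counter grows here and not in \<open>resume\<close>, so that it agrees with the step
  count of \<open>run\<close>. Remainders modulo 4 undo \<open>code_num\<close>;
  \<open>Query\<close>, with code 4, returns \<open>0\<close> because the oracle simulated is
  empty.\<close>

definition exec :: "nat \<Rightarrow> nat \<Rightarrow> nat \<Rightarrow> nat \<Rightarrow> nat" where
  "exec e n x K =
    (if e < 5 then
       config (Suc n)
         (if e = 0 then 0 else if e = 1 then Suc x else if e = 2 then pi1 x else if e = 3 then pi2 x else 0) K
     else let q = (e - 5) div 4; r = (e - 5) mod 4 in
       if r = 0 then config (Suc n) x (push 0 (pi1 q) (push 1 (prod_encode (pi2 q, x)) K))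
       else if r = 1 then config (Suc n) x (push 0 (pi2 q) (push 0 (pi1 q) K))
       else if r = 2 then
         (if pi2 x = 0 then config (Suc n) (pi1 x) (push 0 (pi1 q) K)
          else let a = prod_encode (pi1 x, pi2 x - 1) in
            config (Suc n) a (push 0 e (push 3 (prod_encode (pi2 q, a)) K)))
       else config (Suc n) x (push 0 q (push 4 (prod_encode (e, x)) K)))"

definition resume :: "nat \<Rightarrow> nat \<Rightarrow> nat \<Rightarrow> nat \<Rightarrow> nat \<Rightarrow> nat" where
  "resume tag p n y K =
    (if tag = 1 then config n (pi2 p) (push 0 (pi1 p) (push 2 y K))
     else if tag = 2 then config n (prod_encode (p, y)) K
     else if tag = 3 then
       config n (prod_encode (pi1 (pi2 p), prod_encode (pi2 (pi2 p), y))) (push 0 (pi1 p) K)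
     else if y = 0 then config n (pi2 (pi2 p)) K
     else config n (prod_encode (pi1 (pi2 p), Suc (pi2 (pi2 p)))) (push 0 (pi1 p) K))"

text \<open>A configuration with empty stack is a fixed point, so a result survives any number of
  further iterations.\<close>

definition step :: "nat \<Rightarrow> nat" where
  "step s =
    (let n = pi1 s; v = pi1 (pi2 s); K = pi2 (pi2 s) in
     if K = 0 then s
     else let fr = pi1 (K - 1); K' = pi2 (K - 1) in
       if pi1 fr = 0 then exec (pi2 fr) n v K' else resume (pi1 fr) (pi2 fr) n v K')"

lemma comp_push [comp_intros]: "computable_in A (\<lambda>x. push (f x) (g x) (h x))"
  if "computable_in A f" "computable_in A g" "computable_in A h"
  unfolding push_def by (intro comp_intros that)

lemma comp_config [comp_intros]: "computable_in A (\<lambda>x. config (f x) (g x) (h x))"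
  if "computable_in A f" "computable_in A g" "computable_in A h"
  unfolding config_def by (intro comp_intros that)

lemma comp_exec [comp_intros]: "computable_in A (\<lambda>x. exec (e x) (n x) (v x) (K x))"
  if [comp_intros]: "computable_in A e" "computable_in A n" "computable_in A v" "computable_in A K"
proof -
  have "computable_in A (\<lambda>z. exec (pi1 (pi1 z)) (pi2 (pi1 z)) (pi1 (pi2 z)) (pi2 (pi2 z)))"
    unfolding exec_def by (intro comp_intros)
  from comp_comp[OF this, of "\<lambda>x. prod_encode (prod_encode (e x, n x), prod_encode (v x, K x))"]
  show ?thesis by (simp add: comp_pair that)
qed

lemma comp_resume [comp_intros]: "computable_in A (\<lambda>x. resume (e x) (p x) (n x) (v x) (K x))"
  if [comp_intros]: "computable_in A e" "computable_in A p" "computable_in A n" "computable_in A v" "computable_in A K"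
proof -
  have "computable_in A (\<lambda>z. resume (pi1 (pi1 (pi1 z))) (pi2 (pi1 (pi1 z))) (pi2 (pi1 z)) (pi1 (pi2 z)) (pi2 (pi2 z)))"
    unfolding resume_def by (intro comp_intros)
  from comp_comp[OF this, of "\<lambda>x. prod_encode (prod_encode (prod_encode (e x, p x), n x), prod_encode (v x, K x))"]
  show ?thesis by (simp add: comp_pair that)
qed

lemma comp_step: "computable_in A step"
  unfolding step_def by (intro comp_intros)

lemma config_eq_iff [simp]: "config n v K = config n' v' K' \<longleftrightarrow> n = n' \<and> v = v' \<and> K = K'"
  by (simp add: config_def)

lemma push_neq_0 [simp]: "push tag p K \<noteq> 0"
  by (simp add: push_def)

lemma step_halted [simp]: "step (config n v 0) = config n v 0"
  by (simp add: step_def config_def)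

lemma step_exec [simp]: "step (config n v (push 0 e K)) = exec e n v K"
  by (simp add: step_def config_def push_def)

lemma step_resume [simp]: "tag \<noteq> 0 \<Longrightarrow> step (config n v (push tag p K)) = resume tag p n v K"
  by (simp add: step_def config_def push_def)

lemma exec_simps [simp]:
  "exec (code_num Zero) n x K = config (Suc n) 0 K"
  "exec (code_num Succ) n x K = config (Suc n) (Suc x) K"
  "exec (code_num Proj1) n x K = config (Suc n) (pi1 x) K"
  "exec (code_num Proj2) n x K = config (Suc n) (pi2 x) K"
  "exec (code_num Query) n x K = config (Suc n) 0 K"
  "exec (code_num (Tuple c d)) n x K =
    config (Suc n) x (push 0 (code_num c) (push 1 (prod_encode (code_num d, x)) K))"
  "exec (code_num (Comp c d)) n x K = config (Suc n) x (push 0 (code_num d) (push 0 (code_num c) K))"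
  "exec (code_num (Prec c d)) n (prod_encode (a, 0)) K = config (Suc n) a (push 0 (code_num c) K)"
  "exec (code_num (Prec c d)) n (prod_encode (a, Suc k)) K =
    config (Suc n) (prod_encode (a, k)) (push 0 (code_num (Prec c d))
      (push 3 (prod_encode (code_num d, prod_encode (a, k))) K))"
  "exec (code_num (Mu c)) n x K =
    config (Suc n) x (push 0 (code_num c) (push 4 (prod_encode (code_num (Mu c), x)) K))"
proof -
  have "Suc (4 * q) mod 4 = 1" "Suc (4 * q) div 4 = q" "Suc (Suc (4 * q)) mod 4 = 2"
    "Suc (Suc (4 * q)) div 4 = q" "Suc (Suc (Suc (4 * q))) mod 4 = 3" "Suc (Suc (Suc (4 * q))) div 4 = q" for q :: nat
    by presburger+
  then show
    "exec (code_num Zero) n x K = config (Suc n) 0 K"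
    "exec (code_num Succ) n x K = config (Suc n) (Suc x) K"
    "exec (code_num Proj1) n x K = config (Suc n) (pi1 x) K"
    "exec (code_num Proj2) n x K = config (Suc n) (pi2 x) K"
    "exec (code_num Query) n x K = config (Suc n) 0 K"
    "exec (code_num (Tuple c d)) n x K =
      config (Suc n) x (push 0 (code_num c) (push 1 (prod_encode (code_num d, x)) K))"
    "exec (code_num (Comp c d)) n x K = config (Suc n) x (push 0 (code_num d) (push 0 (code_num c) K))"
    "exec (code_num (Prec c d)) n (prod_encode (a, 0)) K = config (Suc n) a (push 0 (code_num c) K)"
    "exec (code_num (Prec c d)) n (prod_encode (a, Suc k)) K =
      config (Suc n) (prod_encode (a, k)) (push 0 (code_num (Prec c d))
        (push 3 (prod_encode (code_num d, prod_encode (a, k))) K))"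
    "exec (code_num (Mu c)) n x K =
      config (Suc n) x (push 0 (code_num c) (push 4 (prod_encode (code_num (Mu c), x)) K))"
    by (simp_all add: exec_def Let_def)
qed

lemma resume_simps [simp]:
  "resume (Suc 0) (prod_encode (d, x)) n y K = config n x (push 0 d (push 2 y K))"
  "resume 2 y n z K = config n (prod_encode (y, z)) K"
  "resume 3 (prod_encode (d, prod_encode (a, k))) n y K =
    config n (prod_encode (a, prod_encode (k, y))) (push 0 d K)"
  "resume 4 (prod_encode (e, prod_encode (a, m))) n 0 K = config n m K"
  "resume 4 (prod_encode (e, prod_encode (a, m))) n (Suc y) K =
    config n (prod_encode (a, Suc m)) (push 0 e K)"
  by (simp_all add: resume_def)

declare code_num.simps [simp del]

text \<open>Only an upper bound on the number of machine steps is tracked, so the cost of each case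
  can be rounded up to a common bound.\<close>

definition reaches :: "nat \<Rightarrow> nat \<Rightarrow> nat \<Rightarrow> bool" where
  "reaches k s s' \<longleftrightarrow> (\<exists>j\<le>k. (step ^^ j) s = s')"

lemma reaches_refl: "reaches k s s"
  unfolding reaches_def by (intro exI[of _ 0]) simp

lemma reaches_trans: "reaches k s s' \<Longrightarrow> reaches l s' s'' \<Longrightarrow> reaches (k + l) s s''"
  unfolding reaches_def by (metis add_mono funpow_add o_apply add.commute)

lemma reaches_step: "reaches k (step s) s' \<Longrightarrow> reaches (Suc k) s s'"
  unfolding reaches_def by (metis Suc_le_mono funpow_Suc_right o_apply)

lemma reaches_mono: "reaches k s s' \<Longrightarrow> k \<le> l \<Longrightarrow> reaches l s s'"
  unfolding reaches_def using order_trans by blast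

text \<open>The factor 3 counts the pushes and pops that each evaluation step may cost.\<close>

lemma run_imp_reaches:
  "run {} c x y t \<Longrightarrow> reaches (3 * t) (config n x (push 0 (code_num c) K)) (config (n + t) y K)"
proof (induction arbitrary: n K rule: run.induct)
  case (run_Tuple c x y t d z u)
  have "reaches (3 * u + Suc 0) (config (Suc n + t) x (push 0 (code_num d) (push 2 y K)))
      (config (Suc n + t + u) (prod_encode (y, z)) K)"
    by (rule reaches_trans[OF run_Tuple.IH(2)], rule reaches_step) (simp add: reaches_refl)
  then have "reaches (Suc (3 * u + Suc 0))
      (config (Suc n + t) y (push 1 (prod_encode (code_num d, x)) K))
      (config (Suc n + t + u) (prod_encode (y, z)) K)"
    by (intro reaches_step) simp
  from reaches_trans[OF run_Tuple.IH(1) this]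
  have "reaches (Suc (3 * t + Suc (3 * u + Suc 0)))
    (config n x (push 0 (code_num (Tuple c d)) K)) (config (n + Suc (t + u)) (prod_encode (y, z)) K)"
    by (intro reaches_step) (simp add: add.assoc)
  then show ?case by (simp add: eval_nat_numeral add_ac)
next
  case (run_Comp d x y t c z u)
  have "reaches (Suc (3 * t + 3 * u))
    (config n x (push 0 (code_num (Comp c d)) K)) (config (n + Suc (t + u)) z K)"
    by (rule reaches_step, simp only: step_exec exec_simps, rule reaches_trans[OF run_Comp.IH(1)])
      (use run_Comp.IH(2)[of "Suc n + t"] in \<open>simp add: add.assoc\<close>)
  then show ?case by (rule reaches_mono) simp
next
  case (run_Prec_0 c a y t d)
  have "reaches (Suc (3 * t)) (config n (prod_encode (a, 0)) (push 0 (code_num (Prec c d)) K)) (config (n + Suc t) y K)"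
    by (rule reaches_step) (use run_Prec_0.IH[of "Suc n"] in simp)
  then show ?case by (rule reaches_mono) simp
next
  case (run_Prec_Suc c d a k y t z u)
  have "reaches (Suc (3 * t + Suc (3 * u)))
    (config n (prod_encode (a, Suc k)) (push 0 (code_num (Prec c d)) K)) (config (n + Suc (t + u)) z K)"
    by (rule reaches_step, simp only: step_exec exec_simps, rule reaches_trans[OF run_Prec_Suc.IH(1)],
        rule reaches_step) (use run_Prec_Suc.IH(2)[of "Suc n + t"] in \<open>simp add: add.assoc\<close>)
  then show ?case by (rule reaches_mono) simp
next
  case (run_Mu_found c a m t)
  have "reaches (Suc (3 * t + Suc 0))
    (config n (prod_encode (a, m)) (push 0 (code_num (Mu c)) K)) (config (n + Suc t) m K)"
    by (rule reaches_step, simp only: step_exec exec_simps, rule reaches_trans[OF run_Mu_found.IH],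
        rule reaches_step) (simp add: reaches_refl)
  then show ?case by (rule reaches_mono) simp
next
  case (run_Mu_next c a m y t z u)
  have "reaches (Suc (3 * t + Suc (3 * u)))
    (config n (prod_encode (a, m)) (push 0 (code_num (Mu c)) K)) (config (n + Suc (t + u)) z K)"
    by (rule reaches_step, simp only: step_exec exec_simps, rule reaches_trans[OF run_Mu_next.IH(1)],
        rule reaches_step) (use run_Mu_next.IH(2)[of "Suc n + t"] in \<open>simp add: add.assoc\<close>)
  then show ?case by (rule reaches_mono) simp
qed (auto simp: reaches_def intro!: exI[of _ "Suc 0"])

lemma step_pow_pos:
  assumes "(step ^^ N) (config n v (push tag p K)) = config n' v' 0"
  obtains N' where "N = Suc N'" "(step ^^ N') (step (config n v (push tag p K))) = config n' v' 0"
proof (cases N)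
  case (Suc N')
  then show ?thesis using assms that by (simp add: funpow_swap1)
qed (use assms in simp)

text \<open>A computation that eventually empties the stack must have returned from its topmost task.\<close>

lemma halting_imp_run:
  "(step ^^ N) (config n x (push 0 (code_num c) K)) = config n' y' 0 \<Longrightarrow>
    \<exists>y t N'. N' < N \<and> run {} c x y t \<and> (step ^^ N') (config (n + t) y K) = config n' y' 0"
proof (induction N arbitrary: n x c K rule: less_induct)
  case (less N)
  obtain M where N: "N = Suc M" and M: "(step ^^ M) (exec (code_num c) n x K) = config n' y' 0"
    using step_pow_pos[OF less.prems] by auto
  \<comment> \<open>The induction is on the remaining machine steps: \<open>Prec\<close> and
    \<open>Mu\<close> put themselves back on the stack, so the program itself need not get
    smaller.\<close>
  have IH: "\<exists>y t N'. N' < L \<and> run {} d z y t \<and> (step ^^ N') (config (m + t) y J) = config n' y' 0"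
    if "L \<le> M" "(step ^^ L) (config m z (push 0 (code_num d) J)) = config n' y' 0" for L m z d J
    using less.IH that N by (meson le_imp_less_Suc)
  show ?case
  proof (cases c)
    case Zero
    then show ?thesis using M N run_Zero[of "{}" x] by (intro exI[of _ M] exI) auto
  next
    case Succ
    then show ?thesis using M N run_Succ[of "{}" x] by (intro exI[of _ M] exI) auto
  next
    case Proj1
    then show ?thesis using M N run_Proj1[of "{}" x] by (intro exI[of _ M] exI) auto
  next
    case Proj2
    then show ?thesis using M N run_Proj2[of "{}" x] by (intro exI[of _ M] exI) auto
  next
    case Query
    then show ?thesis using M N run_Query[of "{}" x] by (intro exI[of _ M] exI) auto
  next
    case (Tuple d e)
    have "(step ^^ M) (config (Suc n) x (push 0 (code_num d) (push 1 (prod_encode (code_num e, x)) K))) = config n' y' 0"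
      using M Tuple by simp
    from IH[OF order_refl this] obtain y t L where L: "L < M" "run {} d x y t"
      "(step ^^ L) (config (Suc n + t) y (push 1 (prod_encode (code_num e, x)) K)) = config n' y' 0" by blast
    from step_pow_pos[OF L(3)] obtain L' where L': "L = Suc L'"
      "(step ^^ L') (config (Suc n + t) x (push 0 (code_num e) (push 2 y K))) = config n' y' 0"
      by auto
    from IH[OF _ L'(2)] L(1) L'(1) obtain z u J where J: "J < L'" "run {} e x z u"
      "(step ^^ J) (config (Suc n + t + u) z (push 2 y K)) = config n' y' 0" by auto
    from step_pow_pos[OF J(3)] obtain J' where "J = Suc J'"
      "(step ^^ J') (config (Suc n + t + u) (prod_encode (y, z)) K) = config n' y' 0" by auto
    then show ?thesis using Tuple run_Tuple[OF L(2) J(2)] J(1) L(1) L'(1) N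
      by (intro exI[of _ "prod_encode (y, z)"] exI[of _ "Suc (t + u)"] exI[of _ J']) (simp add: add_ac)
  next
    case (Comp d e)
    have "(step ^^ M) (config (Suc n) x (push 0 (code_num e) (push 0 (code_num d) K))) = config n' y' 0"
      using M Comp by simp
    from IH[OF order_refl this] obtain y t L where L: "L < M" "run {} e x y t"
      "(step ^^ L) (config (Suc n + t) y (push 0 (code_num d) K)) = config n' y' 0" by blast
    from IH[OF _ L(3)] L(1) obtain z u J where J: "J < L" "run {} d y z u"
      "(step ^^ J) (config (Suc n + t + u) z K) = config n' y' 0" by auto
    then show ?thesis using Comp run_Comp[OF L(2) J(2)] L(1) N
      by (intro exI[of _ z] exI[of _ "Suc (t + u)"] exI[of _ J]) (simp add: add_ac)
  next
    case (Prec d e)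
    obtain a k where x: "x = prod_encode (a, k)" by (metis prod.collapse prod_decode_inverse)
    show ?thesis
    proof (cases k)
      case 0
      have "(step ^^ M) (config (Suc n) a (push 0 (code_num d) K)) = config n' y' 0"
        using M Prec x 0 by simp
      from IH[OF order_refl this] obtain y t L where L: "L < M" "run {} d a y t"
        "(step ^^ L) (config (Suc n + t) y K) = config n' y' 0" by blast
      then show ?thesis using Prec x 0 run_Prec_0[OF L(2)] N
        by (intro exI[of _ y] exI[of _ "Suc t"] exI[of _ L]) simp
    next
      case (Suc j)
      have "(step ^^ M) (config (Suc n) (prod_encode (a, j)) (push 0 (code_num c)
          (push 3 (prod_encode (code_num e, prod_encode (a, j))) K))) = config n' y' 0"
        using M Prec x Suc by simp
      from IH[OF order_refl this] obtain y t L where L: "L < M" "run {} c (prod_encode (a, j)) y t"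
        "(step ^^ L) (config (Suc n + t) y (push 3 (prod_encode (code_num e, prod_encode (a, j))) K)) = config n' y' 0"
        by blast
      from step_pow_pos[OF L(3)] obtain L' where L': "L = Suc L'"
        "(step ^^ L') (config (Suc n + t) (prod_encode (a, prod_encode (j, y))) (push 0 (code_num e) K)) = config n' y' 0"
        by auto
      from IH[OF _ L'(2)] L(1) L'(1) obtain z u J where J: "J < L'" "run {} e (prod_encode (a, prod_encode (j, y))) z u"
        "(step ^^ J) (config (Suc n + t + u) z K) = config n' y' 0" by auto
      then show ?thesis using x Suc run_Prec_Suc[OF L(2)[unfolded Prec] J(2)] Prec L(1) L'(1) N
        by (intro exI[of _ z] exI[of _ "Suc (t + u)"] exI[of _ J]) (simp add: add_ac)
    qed
  next
    case (Mu d)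
    obtain a m where x: "x = prod_encode (a, m)" by (metis prod.collapse prod_decode_inverse)
    have "(step ^^ M) (config (Suc n) x (push 0 (code_num d) (push 4 (prod_encode (code_num c, x)) K))) = config n' y' 0"
      using M Mu by simp
    from IH[OF order_refl this] obtain y t L where L: "L < M" "run {} d x y t"
      "(step ^^ L) (config (Suc n + t) y (push 4 (prod_encode (code_num c, x)) K)) = config n' y' 0" by blast
    show ?thesis
    proof (cases y)
      case 0
      with step_pow_pos[OF L(3)] obtain L' where L': "L = Suc L'"
        "(step ^^ L') (config (Suc n + t) m K) = config n' y' 0" using x by auto
      then show ?thesis using Mu x 0 run_Mu_found L N
        by (intro exI[of _ m] exI[of _ "Suc t"] exI[of _ L']) simp
    next
      case (Suc w)
      with step_pow_pos[OF L(3)] obtain L' where L': "L = Suc L'"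
        "(step ^^ L') (config (Suc n + t) (prod_encode (a, Suc m)) (push 0 (code_num c) K)) = config n' y' 0"
        using x by auto
      from IH[OF _ L'(2)] L(1) L'(1) obtain z u J where J: "J < L'" "run {} c (prod_encode (a, Suc m)) z u"
        "(step ^^ J) (config (Suc n + t + u) z K) = config n' y' 0" by auto
      then show ?thesis using x Suc run_Mu_next[of "{}" d a m w t z u] Mu L L'(1) N
        by (intro exI[of _ z] exI[of _ "Suc (t + u)"] exI[of _ J]) (simp add: add_ac)
    qed
  qed
qed

text \<open>By \<open>run_imp_reaches\<close>, \<open>3 * s\<close> iterations suffice to complete
  every evaluation of at most \<open>s\<close> steps.\<close>

definition exec_result :: "nat \<Rightarrow> nat \<Rightarrow> nat \<Rightarrow> nat" where
  "exec_result e n s = (step ^^ (3 * s)) (config 0 n (push 0 e 0))"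

lemma step_pow_halted: "(step ^^ k) (config n v 0) = config n v 0"
  by (induction k) auto

text \<open>This makes the stages decidable. The counter has to be checked as well as the stack,
  since an evaluation of more than \<open>s\<close> steps may also finish within
  \<open>3 * s\<close> iterations.\<close>

lemma mem_W_stage_iff:
  "n \<in> W_stage e s \<longleftrightarrow> n < s \<and> pi2 (pi2 (exec_result e n s)) = 0 \<and> pi1 (exec_result e n s) \<le> s"
proof -
  have halts: "pi2 (pi2 (exec_result e n s)) = 0 \<and> pi1 (exec_result e n s) \<le> s"
    if c: "code_num c = e" and "t \<le> s" and run: "run {} c n y t" for c y t
  proof -
    obtain j where "j \<le> 3 * t" "(step ^^ j) (config 0 n (push 0 e 0)) = config t y 0"
      using run_imp_reaches[OF run, of 0 0] c by (auto simp: reaches_def)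
    moreover have "(step ^^ (3 * s)) u = (step ^^ (3 * s - j)) ((step ^^ j) u)" for u
      using \<open>j \<le> 3 * t\<close> \<open>t \<le> s\<close> by (simp flip: funpow_add add: funpow_add[THEN fun_cong, unfolded o_apply, symmetric])
    ultimately have "exec_result e n s = config t y 0"
      unfolding exec_result_def by (simp add: step_pow_halted)
    then show ?thesis using \<open>t \<le> s\<close> by (simp add: config_def)
  qed
  have run: "\<exists>c y t. code_num c = e \<and> t \<le> s \<and> run {} c n y t"
    if halted: "pi2 (pi2 (exec_result e n s)) = 0" "pi1 (exec_result e n s) \<le> s"
  proof -
    obtain c where c: "code_num c = e" using surj_code_num by blast
    obtain k y where r: "exec_result e n s = config k y 0" and "k \<le> s"
    proof
      show "exec_result e n s = config (pi1 (exec_result e n s)) (pi1 (pi2 (exec_result e n s))) 0"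
        by (subst halted(1)[symmetric]) (simp add: config_def)
    qed (rule halted(2))
    from halting_imp_run[of "3 * s" 0 n c 0 k y] r c obtain y' t N' where
      run: "run {} c n y' t" and pow: "(step ^^ N') (config (0 + t) y' 0) = config k y 0"
      unfolding exec_result_def by blast
    \<comment> \<open>The configuration after the run is already halted, so the counter that is read
      off is the length of the run.\<close>
    have "t = k" using pow by (simp add: step_pow_halted)
    then show ?thesis using c run \<open>k \<le> s\<close> by blast
  qed
  show ?thesis unfolding W_stage_def mem_Collect_eq
  proof (intro conj_cong refl iffI)
    assume "\<exists>c y t. code_num c = e \<and> t \<le> s \<and> run {} c n y t"
    then obtain c y t where "code_num c = e" "t \<le> s" "run {} c n y t" by blast
    then show "pi2 (pi2 (exec_result e n s)) = 0 \<and> pi1 (exec_result e n s) \<le> s" by (rule halts)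
  next
    assume "pi2 (pi2 (exec_result e n s)) = 0 \<and> pi1 (exec_result e n s) \<le> s"
    then show "\<exists>c y t. code_num c = e \<and> t \<le> s \<and> run {} c n y t" by (intro run) simp_all
  qed
qed

lemma comp_W_stage [comp_intros]: "computable_in A (\<lambda>x. of_bool (f x \<in> W_stage (g x) (h x)))"
  if [comp_intros]: "computable_in A f" "computable_in A g" "computable_in A h"
  unfolding mem_W_stage_iff exec_result_def by (intro comp_intros comp_funpow comp_step)

section \<open>The limit lemma\<close>

text \<open>A halting search contains terminating runs at all positions that it tried. The limit
  lemma needs these runs, because approximations are known to converge only where the program
  halts.\<close>

lemma run_Mu_value:
  assumes "run A (Mu c) (prod_encode (a, m)) k t"
  shows "m \<le> k \<and> (\<exists>u. run A c (prod_encode (a, k)) 0 u) \<and>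
    (\<forall>i. m \<le> i \<and> i < k \<longrightarrow> (\<exists>y u. run A c (prod_encode (a, i)) (Suc y) u))"
proof -
  have "run A d x k t \<Longrightarrow> d = Mu c \<Longrightarrow> x = prod_encode (a, m) \<Longrightarrow> ?thesis" for d x
  proof (induction arbitrary: m rule: run.induct)
    case (run_Mu_next c' a' m' y t z u)
    then have "\<exists>y u. run A c (prod_encode (a, i)) (Suc y) u" if "m \<le> i" "i < z" for i
      using that by (cases "i = m") (auto simp: Suc_le_eq)
    then show ?case using run_Mu_next by auto
  qed auto
  then show ?thesis using assms by blast
qed

lemma zero_jump_limit:
  "\<forall>\<^sub>F s in sequentially. (x \<in> W_stage x s) = (x \<in> zero_jump)"
proof (cases "x \<in> zero_jump")
  case True
  then obtain s where "x \<in> W_stage x s"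
    unfolding zero_jump_def using UN_W_stage by blast
  then have "x \<in> W_stage x s'" if "s \<le> s'" for s'
    using monoD[OF mono_W_stage that] by blast
  then show ?thesis using True eventually_sequentially by blast
next
  case False
  then show ?thesis unfolding zero_jump_def using UN_W_stage by (intro always_eventually) blast
qed

text \<open>The approximation is total, but convergence is demanded only where the program halts.
  This lets an induction over programs pass through partial subprograms.\<close>

definition limit_computes :: "(nat \<Rightarrow> nat \<Rightarrow> nat) \<Rightarrow> code \<Rightarrow> bool" where
  "limit_computes g c \<longleftrightarrow> (\<forall>D. computable_in D (\<lambda>z. g (pi1 z) (pi2 z))) \<and>
    (\<forall>x y t. run zero_jump c x y t \<longrightarrow> (\<forall>\<^sub>F s in sequentially. g x s = y))"

lemma limit_computesI:
  "(\<And>D. computable_in D (\<lambda>z. g (pi1 z) (pi2 z))) \<Longrightarrow>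
    (\<And>x y t. run zero_jump c x y t \<Longrightarrow> \<forall>\<^sub>F s in sequentially. g x s = y) \<Longrightarrow> limit_computes g c"
  unfolding limit_computes_def by blast

lemma limit_computesD:
  assumes "limit_computes g c"
  shows "computable_in D (\<lambda>z. g (pi1 z) (pi2 z))"
    and "run zero_jump c x y t \<Longrightarrow> \<forall>\<^sub>F s in sequentially. g x s = y"
  using assms unfolding limit_computes_def by blast+

lemma limit_lemma_code: "\<exists>g. limit_computes g c"
proof (induction c)
  case Zero
  then show ?case by (intro exI[of _ "\<lambda>x s. 0"] limit_computesI comp_intros) (auto elim: run_ZeroE)
next
  case Succ
  then show ?case by (intro exI[of _ "\<lambda>x s. Suc x"] limit_computesI comp_intros) (auto elim: run_SuccE)
next
  case Proj1
  then show ?case by (intro exI[of _ "\<lambda>x s. pi1 x"] limit_computesI comp_intros) (auto elim: run_Proj1E)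
next
  case Proj2
  then show ?case by (intro exI[of _ "\<lambda>x s. pi2 x"] limit_computesI comp_intros) (auto elim: run_Proj2E)
next
  case Query
  have "\<forall>\<^sub>F s in sequentially. of_bool (x \<in> W_stage x s) = y" if "run zero_jump Query x y t" for x y t
    using zero_jump_limit[of x] that by (auto elim!: run_QueryE eventually_mono)
  then show ?case by (intro exI[of _ "\<lambda>x s. of_bool (x \<in> W_stage x s)"] limit_computesI comp_intros)
next
  case (Tuple c d)
  then obtain f g where fg: "limit_computes f c" "limit_computes g d" by blast
  note f = limit_computesD(1)[OF fg(1)] and g = limit_computesD(1)[OF fg(2)]
    and lim = limit_computesD(2)[OF fg(1)] limit_computesD(2)[OF fg(2)]
  have "\<forall>\<^sub>F s in sequentially. prod_encode (f x s, g x s) = y" if "run zero_jump (Tuple c d) x y t" for x y t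
    using that
  proof (rule run_TupleE)
    fix v w t u assume "run zero_jump c x v t" "run zero_jump d x w u" and y: "y = prod_encode (v, w)"
    from lim(1)[OF this(1)] lim(2)[OF this(2)] show ?thesis by eventually_elim (simp add: y)
  qed
  moreover have "computable_in D (\<lambda>z. prod_encode (f (pi1 z) (pi2 z), g (pi1 z) (pi2 z)))" for D
    by (intro comp_pair f g)
  ultimately have "limit_computes (\<lambda>x s. prod_encode (f x s, g x s)) (Tuple c d)" by (intro limit_computesI)
  then show ?case by blast
next
  case (Comp c d)
  then obtain f g where fg: "limit_computes f c" "limit_computes g d" by blast
  note f = limit_computesD(1)[OF fg(1)] and g = limit_computesD(1)[OF fg(2)]
    and lim = limit_computesD(2)[OF fg(1)] limit_computesD(2)[OF fg(2)]
  \<comment> \<open>Both approximations are taken at the same stage: once \<open>g x s\<close> has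
    settled at the inner value, the outer argument no longer moves.\<close>
  have "\<forall>\<^sub>F s in sequentially. f (g x s) s = z" if "run zero_jump (Comp c d) x z t" for x z t
    using that
  proof (rule run_CompE)
    fix y u v assume "run zero_jump d x y u" "run zero_jump c y z v"
    from lim(2)[OF this(1)] lim(1)[OF this(2)] show ?thesis by eventually_elim simp
  qed
  moreover have "computable_in D (\<lambda>z. f (g (pi1 z) (pi2 z)) (pi2 z))" for D
    by (intro comp_comp2[OF f] g comp_intros)
  ultimately have "limit_computes (\<lambda>x s. f (g x s) s) (Comp c d)" by (intro limit_computesI)
  then show ?case by blast
next
  case (Prec c d)
  then obtain f g where fg: "limit_computes f c" "limit_computes g d" by blast
  note f = limit_computesD(1)[OF fg(1)] and g = limit_computesD(1)[OF fg(2)]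
    and lim = limit_computesD(2)[OF fg(1)] limit_computesD(2)[OF fg(2)]
  define h where "h x s = rec_nat (f (pi1 x) s) (\<lambda>n y. g (prod_encode (pi1 x, prod_encode (n, y))) s) (pi2 x)" for x s
  have "\<forall>\<^sub>F s in sequentially. h (prod_encode (a, n)) s = y"
    if "run zero_jump (Prec c d) (prod_encode (a, n)) y t" for a n y t
    using that
  proof (induction n arbitrary: y t)
    case 0
    then obtain u where "run zero_jump c a y u" by (auto elim: run_PrecE)
    then show ?case using lim(1) by (simp add: h_def)
  next
    case (Suc n)
    then obtain v u u' where v: "run zero_jump (Prec c d) (prod_encode (a, n)) v u"
      "run zero_jump d (prod_encode (a, prod_encode (n, v))) y u'" by (auto elim: run_PrecE)
    from Suc.IH[OF v(1)] lim(2)[OF v(2)] show ?case by eventually_elim (simp add: h_def)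
  qed
  then have "\<forall>\<^sub>F s in sequentially. h x s = y" if "run zero_jump (Prec c d) x y t" for x y t
    using that by (metis prod.collapse prod_decode_inverse)
  moreover have "computable_in D (\<lambda>z. h (pi1 z) (pi2 z))" for D
    unfolding h_def by (intro comp_rec comp_comp2[OF f] comp_comp2[OF g] comp_intros)
  ultimately have "limit_computes h (Prec c d)" by (intro limit_computesI)
  then show ?case by blast
next
  case (Mu c)
  then obtain f where fc: "limit_computes f c" by blast
  note f = limit_computesD(1)[OF fc] and lim = limit_computesD(2)[OF fc]
  \<comment> \<open>The alternative \<open>s \<le> k\<close> cuts the search off at the stage, which
    makes it total; it is harmless once \<open>s\<close> exceeds the true result.\<close>
  define h where "h x s = (LEAST k. s \<le> k \<or> pi2 x \<le> k \<and> f (prod_encode (pi1 x, k)) s = 0)" for x s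
  have "\<forall>\<^sub>F s in sequentially. h (prod_encode (a, m)) s = k"
    if "run zero_jump (Mu c) (prod_encode (a, m)) k t" for a m k t
  proof -
    note v = run_Mu_value[OF that]
    have "\<forall>\<^sub>F s in sequentially. f (prod_encode (a, k)) s = 0" using v lim by blast
    moreover have "\<forall>\<^sub>F s in sequentially. \<forall>i\<in>{m..<k}. f (prod_encode (a, i)) s \<noteq> 0"
    proof (intro eventually_ball_finite ballI)
      fix i assume "i \<in> {m..<k}"
      then obtain y u where "run zero_jump c (prod_encode (a, i)) (Suc y) u" using v by auto
      from lim[OF this] show "\<forall>\<^sub>F s in sequentially. f (prod_encode (a, i)) s \<noteq> 0"
        by eventually_elim simp
    qed simp
    moreover have "\<forall>\<^sub>F s in sequentially. k < s" by (rule eventually_gt_at_top)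
    ultimately show ?thesis
    proof eventually_elim
      case (elim s)
      show ?case unfolding h_def
      proof (rule Least_equality)
        fix y assume "s \<le> y \<or> pi2 (prod_encode (a, m)) \<le> y \<and> f (prod_encode (pi1 (prod_encode (a, m)), y)) s = 0"
        then show "k \<le> y" using elim(2,3) by (cases "y < k") (auto dest: bspec[of _ _ y])
      qed (use v elim(1) in simp)
    qed
  qed
  then have "\<forall>\<^sub>F s in sequentially. h x s = y" if "run zero_jump (Mu c) x y t" for x y t
    using that by (metis prod.collapse prod_decode_inverse)
  moreover have "computable_in D (\<lambda>z. h (pi1 z) (pi2 z))" for D
    unfolding h_def by (intro comp_Least comp_comp2[OF f] comp_intros) (metis order_refl)
  ultimately have "limit_computes h (Mu c)" by (intro limit_computesI)
  then show ?case by blast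
qed

text \<open>Computability is stated relative to every oracle because the construction and the test
  use the empty oracle, while the decoding uses \<open>D\<close>.\<close>

locale computable_approximation =
  fixes G :: "nat \<Rightarrow> nat set" and X :: "nat set"
  assumes comp_G [comp_intros]:
      "\<And>D f g. computable_in D f \<Longrightarrow> computable_in D g \<Longrightarrow> computable_in D (\<lambda>x. of_bool (f x \<in> G (g x)))"
    and G_lim: "\<And>x. \<forall>\<^sub>F s in sequentially. x \<in> G s \<longleftrightarrow> x \<in> X"

lemma limit_lemma:
  assumes "X \<le>\<^sub>T zero_jump"
  shows "\<exists>G. computable_approximation G X"
proof -
  obtain c where c: "\<And>x. \<exists>t. run zero_jump c x (of_bool (x \<in> X)) t"
    using assms unfolding turing_le_def computable_in_def by blast
  obtain g where gc: "limit_computes g c" using limit_lemma_code by blast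
  note g = limit_computesD(1)[OF gc] and lim = limit_computesD(2)[OF gc]
  have "computable_approximation (\<lambda>s. {x. g x s \<noteq> 0}) X"
  proof
    show "\<forall>\<^sub>F s in sequentially. x \<in> {x. g x s \<noteq> 0} \<longleftrightarrow> x \<in> X" for x
      using c[of x] by (auto dest!: lim elim: eventually_mono)
    show "computable_in D (\<lambda>x. of_bool (f x \<in> {y. g y (h x) \<noteq> 0}))"
      if "computable_in D f" "computable_in D h" for D f h
      unfolding mem_Collect_eq by (intro comp_not comp_of_nat_zero comp_comp2[OF g] that)
  qed
  then show ?thesis by blast
qed

section \<open>The measure of Hamming balls\<close>

text \<open>The bounded sum fits the closure rules for computability; \<open>hamming_eq_card\<close>
  translates it into the cardinality that occurs in densities.\<close>

definition hamming :: "nat \<Rightarrow> nat set \<Rightarrow> nat set \<Rightarrow> nat" where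
  "hamming n Y Z = (\<Sum>i<n. of_bool ((i \<in> Y) \<noteq> (i \<in> Z)))"

definition hamming_ball :: "nat \<Rightarrow> nat \<Rightarrow> nat set \<Rightarrow> (nat \<Rightarrow> bool) set" where
  "hamming_ball n r Z = {Y. hamming n (Collect Y) Z < r}"

lemma hamming_commute: "hamming n Y Z = hamming n Z Y"
  unfolding hamming_def by (intro sum.cong) auto

lemma hamming_triangle: "hamming n X Z \<le> hamming n X Y + hamming n Y Z"
  unfolding hamming_def sum.distrib[symmetric] by (intro sum_mono) auto

lemma hamming_cong: "(\<And>i. i < n \<Longrightarrow> i \<in> Z \<longleftrightarrow> i \<in> Z') \<Longrightarrow> hamming n Y Z = hamming n Y Z'"
  unfolding hamming_def by (intro sum.cong) auto

lemma hamming_eq_card: "hamming n Y Z = card (sym_diff Y Z \<inter> {0..<n})"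
proof -
  have "hamming n Y Z = card ({..<n} \<inter> {i. (i \<in> Y) \<noteq> (i \<in> Z)})"
    unfolding hamming_def by simp
  also have "{..<n} \<inter> {i. (i \<in> Y) \<noteq> (i \<in> Z)} = sym_diff Y Z \<inter> {0..<n}" by auto
  finally show ?thesis .
qed

section \<open>Independent fair coin tosses and Hoeffding's inequality\<close>

abbreviation coin :: "bool measure" where "coin \<equiv> uniform_count_measure UNIV"

lemma prob_space_coin: "prob_space coin"
  by (intro prob_space_uniform_count_measure) auto

interpretation coins: product_prob_space "\<lambda>_ :: nat. coin" UNIV
  using prob_space_coin by (simp add: product_prob_space_def product_sigma_finite_def
      product_prob_space_axioms_def prob_space_imp_sigma_finite)

interpretation cantor: prob_space cantor_measure
  unfolding cantor_measure_def by (rule coins.P.prob_space_axioms)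

lemma space_cantor_measure [simp]: "space cantor_measure = UNIV"
  by (simp add: cantor_measure_def space_PiM space_uniform_count_measure)

lemma measurable_coordinate [measurable]: "(\<lambda>Y. Y i) \<in> cantor_measure \<rightarrow>\<^sub>M coin"
  unfolding cantor_measure_def by (rule measurable_component_singleton) simp

lemma measurable_from_coin [measurable]: "f \<in> coin \<rightarrow>\<^sub>M borel"
  for f :: "bool \<Rightarrow> 'a :: topological_space"
  by (rule measurableI) (auto simp: sets_uniform_count_measure_eq_UNIV)

lemma distr_coordinate: "distr cantor_measure coin (\<lambda>Y. Y i) = coin"
  unfolding cantor_measure_def by (rule coins.PiM_component) simp

text \<open>The joint law of the coordinates is the measure itself, which is the product of its
  marginals by construction.\<close>

lemma indep_coordinates: "cantor.indep_vars (\<lambda>_. coin) (\<lambda>i Y. Y i) UNIV"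
  by (subst cantor.indep_vars_iff_distr_eq_PiM')
    (auto simp: distr_coordinate restrict_UNIV cantor_measure_def[symmetric] distr_id)

text \<open>The distance to the fixed \<open>Z\<close> is a sum of \<open>2 * 8 ^ e\<close>
  independent fair bits, with mean \<open>8 ^ e\<close>. Hoeffding's inequality for the deviation
  \<open>4 ^ e\<close> gives the bound
  \<open>exp (- 2 * 16 ^ e / (2 * 8 ^ e)) = exp (- (2 ^ e))\<close>, and \<open>exp (2 ^ e)\<close>
  is at least \<open>2 ^ e\<close>.\<close>

lemma measure_hamming_ball:
  "measure cantor_measure (hamming_ball (2 * 8 ^ e) (8 ^ e - 4 ^ e) Z) \<le> (1 / 2) ^ e"
proof -
  define X where "X i Y = (of_bool (Y i \<noteq> (i \<in> Z)) :: real)" for i and Y :: "nat \<Rightarrow> bool"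
  have [measurable]: "X i \<in> borel_measurable cantor_measure" for i
    unfolding X_def by (rule measurable_compose[OF measurable_coordinate measurable_from_coin])
  have expectation: "cantor.expectation (X i) = 1 / 2" for i
  proof -
    have "cantor.expectation (X i) = (\<integral>y. of_bool (y \<noteq> (i \<in> Z)) \<partial>distr cantor_measure coin (\<lambda>Y. Y i))"
      unfolding X_def by (subst integral_distr) auto
    also have "\<dots> = 1 / 2"
      unfolding distr_coordinate by (subst integral_uniform_count_measure) (auto simp: UNIV_bool)
    finally show ?thesis .
  qed
  have "cantor.indep_vars (\<lambda>_. borel) X {..<2 * 8 ^ e}"
    unfolding X_def
    by (rule cantor.indep_vars_compose2[OF cantor.indep_vars_subset[OF indep_coordinates]]) auto
  then interpret Hoeffding_ineq cantor_measure "{..<2 * 8 ^ e}" X "\<lambda>_. 0" "\<lambda>_. 1" "8 ^ e"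
    by unfold_locales (auto simp: expectation, auto simp: X_def)
  have "hamming_ball (2 * 8 ^ e) (8 ^ e - 4 ^ e) Z \<subseteq>
    {Y \<in> space cantor_measure. (\<Sum>i<2 * 8 ^ e. X i Y) \<le> 8 ^ e - 4 ^ e}"
  proof
    fix Y assume Y: "Y \<in> hamming_ball (2 * 8 ^ e) (8 ^ e - 4 ^ e) Z"
    have "(\<Sum>i<2 * 8 ^ e. X i Y) = real (hamming (2 * 8 ^ e) (Collect Y) Z)"
      unfolding hamming_def X_def by simp
    also have "\<dots> \<le> real (8 ^ e - 4 ^ e)"
      using Y unfolding hamming_ball_def by (intro of_nat_mono) simp
    also have "\<dots> = 8 ^ e - 4 ^ e" by (simp add: of_nat_diff power_mono)
    finally show "Y \<in> {Y \<in> space cantor_measure. (\<Sum>i<2 * 8 ^ e. X i Y) \<le> 8 ^ e - 4 ^ e}" by simp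
  qed
  then have "measure cantor_measure (hamming_ball (2 * 8 ^ e) (8 ^ e - 4 ^ e) Z) \<le>
      measure cantor_measure {Y \<in> space cantor_measure. (\<Sum>i<2 * 8 ^ e. X i Y) \<le> 8 ^ e - 4 ^ e}"
    by (rule cantor.finite_measure_mono) measurable
  also have "\<dots> \<le> exp (- 2 * (4 ^ e)\<^sup>2 / (\<Sum>i<2 * (8::nat) ^ e. (1 - 0)\<^sup>2))"
    by (rule Hoeffding_ineq_le) (auto simp: card_gt_0_iff)
  also have "- 2 * (4 ^ e)\<^sup>2 / (\<Sum>i<2 * (8::nat) ^ e. (1 - 0)\<^sup>2) = - (2 ^ e :: real)"
  proof -
    have "(4 ^ e)\<^sup>2 = (2 ^ e * 8 ^ e :: real)"
      by (simp add: power_mult_distrib[symmetric] power2_eq_square)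
    then show ?thesis by simp
  qed
  also have "exp (- (2 ^ e :: real)) \<le> (1 / 2) ^ e"
  proof -
    have "(2::real) ^ e \<le> exp (2 ^ e)" using exp_ge_add_one_self[of "2 ^ e :: real"] by linarith
    then have "inverse (exp (2 ^ e)) \<le> inverse ((2::real) ^ e)" by (intro le_imp_inverse_le) auto
    then show ?thesis by (simp add: exp_minus power_one_over inverse_eq_divide)
  qed
  finally show ?thesis .
qed

lemma sets_hamming_ball [measurable]: "hamming_ball n r Z \<in> sets cantor_measure"
proof -
  have "(\<lambda>Y. \<Sum>i<n. of_bool (Y i \<noteq> (i \<in> Z)) :: real) \<in> borel_measurable cantor_measure"
    by (intro borel_measurable_sum measurable_compose[OF measurable_coordinate measurable_from_coin])
  then have "{Y \<in> space cantor_measure. (\<Sum>i<n. of_bool (Y i \<noteq> (i \<in> Z)) :: real) < real r} \<in> sets cantor_measure"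
    by measurable
  also have "{Y \<in> space cantor_measure. (\<Sum>i<n. of_bool (Y i \<noteq> (i \<in> Z)) :: real) < real r} = hamming_ball n r Z"
  proof -
    have "(\<Sum>i<n. of_bool (Y i \<noteq> (i \<in> Z)) :: real) = real (hamming n (Collect Y) Z)" for Y
      unfolding hamming_def by simp
    then show ?thesis unfolding hamming_ball_def by simp
  qed
  finally show ?thesis .
qed

section \<open>The promptly simple set\<close>

text \<open>The margin \<open>4 ^ e\<close> grows faster than the standard deviation, which has
  order \<open>sqrt (8 ^ e)\<close>, so the balls are small; it is negligible against
  \<open>8 ^ e\<close>, so the density threshold stays \<open>1 / 4\<close>.\<close>

definition radius :: "nat \<Rightarrow> nat" where "radius e = 8 ^ e - 4 ^ e"
definition len :: "nat \<Rightarrow> nat" where "len e = 2 * 8 ^ e"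

lemma comp_radius [comp_intros]: "computable_in A (\<lambda>x. radius (f x))" if "computable_in A f"
  unfolding radius_def by (intro comp_intros that)

lemma comp_len [comp_intros]: "computable_in A (\<lambda>x. len (f x))" if "computable_in A f"
  unfolding len_def by (intro comp_intros that)

definition tail :: "nat \<Rightarrow> nat" where "tail w = pi2 (w - 1)"

text \<open>Positions beyond the end of the coded string count as errors, so that every string
  with few errors generates a subset of the Hamming ball.\<close>

definition errors :: "nat \<Rightarrow> nat \<Rightarrow> nat set \<Rightarrow> nat" where
  "errors n w Z = (\<Sum>i<n. of_bool ((tail ^^ i) w = 0 \<or> (pi1 ((tail ^^ i) w - 1) \<noteq> 0) \<noteq> (i \<in> Z)))"

lemma tail_pow_string_num: "(tail ^^ i) (string_num \<sigma>) = string_num (drop i \<sigma>)"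
proof (induction i arbitrary: \<sigma>)
  case (Suc i)
  have "tail (string_num \<tau>) = string_num (drop 1 \<tau>)" for \<tau>
  proof (cases \<tau>)
    case Nil
    \<comment> \<open>Since \<open>0\<close> codes the pair of zeros, truncated subtraction makes
      the empty list its own tail.\<close>
    have "pi2 (prod_encode (0, 0)) = 0" by simp
    then have "pi2 0 = 0" by (simp add: prod_encode_def)
    then show ?thesis using Nil by (simp add: tail_def string_num_def)
  qed (simp add: tail_def string_num_def)
  then show ?case using Suc by simp
qed simp

lemma errors_string_num:
  "errors n (string_num \<sigma>) Z = (\<Sum>i<n. of_bool (i < length \<sigma> \<longrightarrow> \<sigma> ! i \<noteq> (i \<in> Z)))"
proof -
  have "(string_num \<tau> = 0 \<or> (pi1 (string_num \<tau> - 1) \<noteq> 0) \<noteq> b) \<longleftrightarrow> (\<tau> \<noteq> [] \<longrightarrow> hd \<tau> \<noteq> b)" for \<tau> b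
    by (cases \<tau>) (auto simp: string_num_def)
  then show ?thesis unfolding errors_def tail_pow_string_num by (auto simp: hd_drop_conv_nth not_le intro!: sum.cong)
qed

text \<open>A member of the ball is caught by its own prefix of length \<open>n\<close>; conversely,
  \<open>errors\<close> can only overestimate the distance of a sequence through the string.\<close>

lemma hamming_ball_open:
  "hamming_ball n r Z = (\<Union>\<sigma>\<in>{\<sigma>. errors n (string_num \<sigma>) Z < r}. cylinder \<sigma>)"
proof (intro set_eqI iffI)
  fix Y assume Y: "Y \<in> hamming_ball n r Z"
  define \<sigma> where "\<sigma> = map Y [0..<n]"
  have "errors n (string_num \<sigma>) Z = hamming n (Collect Y) Z"
    unfolding errors_string_num hamming_def \<sigma>_def by (intro sum.cong) auto
  moreover have "Y \<in> cylinder \<sigma>" by (simp add: cylinder_def \<sigma>_def)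
  ultimately show "Y \<in> (\<Union>\<sigma>\<in>{\<sigma>. errors n (string_num \<sigma>) Z < r}. cylinder \<sigma>)"
    using Y by (intro UN_I[of \<sigma>]) (simp_all add: hamming_ball_def)
next
  fix Y assume "Y \<in> (\<Union>\<sigma>\<in>{\<sigma>. errors n (string_num \<sigma>) Z < r}. cylinder \<sigma>)"
  then obtain \<sigma> where \<sigma>: "errors n (string_num \<sigma>) Z < r" "Y \<in> cylinder \<sigma>" by blast
  have "hamming n (Collect Y) Z \<le> errors n (string_num \<sigma>) Z"
    unfolding errors_string_num hamming_def using \<sigma>(2) by (intro sum_mono) (auto simp: cylinder_def)
  then show "Y \<in> hamming_ball n r Z" using \<sigma>(1) by (simp add: hamming_ball_def)
qed

context computable_approximation
begin

lemma comp_hamming [comp_intros]: "computable_in D (\<lambda>x. hamming (f x) D (G (g x)))"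
  if "computable_in D f" "computable_in D g"
proof -
  have "computable_in D (\<lambda>x. hamming (pi1 x) D (G (pi2 x)))"
    unfolding hamming_def by (intro comp_intros)
  from comp_comp2[OF this that] show ?thesis .
qed

lemma comp_errors [comp_intros]: "computable_in D (\<lambda>x. errors (f x) (g x) (G (h x)))"
  if "computable_in D f" "computable_in D g" "computable_in D h"
proof -
  have tail: "computable_in D tail" unfolding tail_def by (intro comp_intros)
  have "computable_in D (\<lambda>x. errors (pi1 x) (pi1 (pi2 x)) (G (pi2 (pi2 x))))"
    unfolding errors_def by (intro comp_intros comp_funpow tail)
  from comp_comp3[OF this that] show ?thesis .
qed

text \<open>Here \<open>z\<close> codes the pair of a stage and a number \<open>n\<close>. An approximation to the set that is
  read off at any stage after \<open>n\<close> is then still correct below \<open>len e\<close> when \<open>n\<close> is enumerated.\<close>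

definition candidate :: "nat \<Rightarrow> nat \<Rightarrow> bool" where
  "candidate e z \<longleftrightarrow> pi2 z \<in> W_stage e (pi1 z) \<and> pi2 z \<notin> W_stage e (pi1 z - 1) \<and> 2 * e \<le> pi2 z \<and>
    (\<forall>u<Suc (pi1 z). pi2 z \<le> u \<longrightarrow> (\<forall>i<len e. i \<in> G u \<longleftrightarrow> i \<in> G (pi1 z)))"

text \<open>Taking the least candidate lets each requirement act at most once, so it contributes at
  most one number to the set and one ball to the test.\<close>

definition acts :: "nat \<Rightarrow> nat \<Rightarrow> bool" where
  "acts e z \<longleftrightarrow> candidate e z \<and> (\<forall>y<z. \<not> candidate e y)"

text \<open>The bound on \<open>e\<close> keeps the stage decidable and loses nothing, because a
  requirement that enumerates \<open>n\<close> satisfies \<open>2 * e \<le> n\<close>.\<close>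

definition A_stage :: "nat \<Rightarrow> nat set" where
  "A_stage u = {n. \<exists>z<u. pi2 z = n \<and> (\<exists>e<Suc n. acts e z)}"

definition A :: "nat set" where
  "A = {n. \<exists>e z. acts e z \<and> pi2 z = n}"

lemma comp_candidate [comp_intros]: "computable_in D (\<lambda>x. of_bool (candidate (f x) (g x)))"
  if "computable_in D f" "computable_in D g"
proof -
  have "computable_in D (\<lambda>x. of_bool (candidate (pi1 x) (pi2 x)))"
    unfolding candidate_def by (intro comp_intros)
  from comp_comp2[OF this that] show ?thesis .
qed

lemma comp_acts [comp_intros]: "computable_in D (\<lambda>x. of_bool (acts (f x) (g x)))"
  if "computable_in D f" "computable_in D g"
proof -
  have "computable_in D (\<lambda>x. of_bool (acts (pi1 x) (pi2 x)))"
    unfolding acts_def by (intro comp_intros)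
  from comp_comp2[OF this that] show ?thesis .
qed

lemma comp_A_stage: "computable_in D (\<lambda>x. of_bool (f x \<in> A_stage (g x)))"
  if "computable_in D f" "computable_in D g"
proof -
  have "computable_in D (\<lambda>x. of_bool (pi1 x \<in> A_stage (pi2 x)))"
    unfolding A_stage_def mem_Collect_eq by (intro comp_intros)
  from comp_comp2[OF this that] show ?thesis .
qed

lemma acts_le: "acts e z \<Longrightarrow> 2 * e \<le> pi2 z"
  by (simp add: acts_def candidate_def)

lemma acts_unique: "acts e z \<Longrightarrow> acts e z' \<Longrightarrow> z = z'"
  unfolding acts_def by (metis linorder_neqE_nat)

lemma pi2_le: "pi2 z \<le> z"
  by (metis le_prod_encode_2 prod.collapse prod_decode_inverse)

lemma A_stage_enumeration: "computable_enumeration A_stage A"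
proof -
  have bound: "A_stage u \<subseteq> {..<u}" for u
    unfolding A_stage_def using pi2_le le_less_trans by blast
  have "set_encode (A_stage u) = (\<Sum>n<u. of_bool (n \<in> A_stage u) * 2 ^ n)" for u
  proof -
    have "set_encode (A_stage u) = (\<Sum>n\<in>{..<u} \<inter> A_stage u. 2 ^ n)"
      using bound[of u] by (simp add: set_encode_def Int_absorb1 del: sum.inter_restrict)
    also have "\<dots> = (\<Sum>n<u. if n \<in> A_stage u then 2 ^ n else 0)"
      by (rule sum.inter_restrict) simp
    also have "\<dots> = (\<Sum>n<u. of_bool (n \<in> A_stage u) * 2 ^ n)"
      by (intro sum.cong) simp_all
    finally show ?thesis .
  qed
  moreover have "computable (\<lambda>u. \<Sum>n<u. of_bool (n \<in> A_stage u) * 2 ^ n)"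
    by (intro comp_intros comp_A_stage)
  ultimately have "computable (\<lambda>u. set_encode (A_stage u))" by simp
  moreover have "finite (A_stage u)" for u using bound finite_subset by blast
  moreover have "mono A_stage" unfolding A_stage_def by (intro monoI) (auto intro: less_le_trans)
  moreover have "(\<Union>u. A_stage u) = A"
  proof
    show "A \<subseteq> (\<Union>u. A_stage u)"
    proof
      fix n assume "n \<in> A"
      then obtain e z where "acts e z" "pi2 z = n" unfolding A_def by blast
      moreover from this have "e < Suc n" using acts_le[of e z] by simp
      ultimately have "n \<in> A_stage (Suc z)" unfolding A_stage_def by blast
      then show "n \<in> (\<Union>u. A_stage u)" by blast
    qed
  qed (auto simp: A_stage_def A_def)
  ultimately show ?thesis unfolding computable_enumeration_def by blast
qed

lemma ce_A: "ce A"
proof -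
  have "ce {n. \<exists>u. n \<in> A_stage u}"
    by (rule ce_projection, rule comp_A_stage) (intro comp_intros)+
  moreover have "{n. \<exists>u. n \<in> A_stage u} = A"
    using A_stage_enumeration unfolding computable_enumeration_def by blast
  ultimately show ?thesis by simp
qed

text \<open>Each requirement contributes at most one element, and that of \<open>e\<close> is at least \<open>2 * e\<close>.\<close>

lemma infinite_compl_A: "infinite (- A)"
proof
  assume fin: "finite (- A)"
  have card: "card (A \<inter> {..<2 * m}) \<le> m" for m
  proof -
    define a where "a e = pi2 (THE z. acts e z)" for e
    have "A \<inter> {..<2 * m} \<subseteq> a ` {..<m}"
    proof
      fix n assume n: "n \<in> A \<inter> {..<2 * m}"
      then obtain e z where e: "acts e z" "pi2 z = n" unfolding A_def by blast
      then have "(THE z. acts e z) = z" using acts_unique by blast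
      moreover have "e < m" using acts_le[OF e(1)] e(2) n by simp
      ultimately show "n \<in> a ` {..<m}" using e(2) by (auto simp: a_def)
    qed
    then have "card (A \<inter> {..<2 * m}) \<le> card (a ` {..<m})" by (intro card_mono) auto
    also have "\<dots> \<le> m" using card_image_le[of "{..<m}" a] by simp
    finally show ?thesis .
  qed
  \<comment> \<open>Below \<open>2 * m\<close> at least \<open>m\<close> numbers lie outside the
    set, one more than its complement was supposed to have.\<close>
  define m where "m = Suc (card (- A))"
  have "2 * m = card ({..<2 * m} \<inter> A) + card ({..<2 * m} - A)"
    by (metis card_Int_Diff card_lessThan finite_lessThan)
  moreover have "card ({..<2 * m} - A) \<le> card (- A)" using fin by (intro card_mono) auto
  ultimately show False using card[of m] by (simp add: m_def Int_commute)
qed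

lemma eventually_G_agrees: "\<forall>\<^sub>F s in sequentially. \<forall>i<n. i \<in> G s \<longleftrightarrow> i \<in> X"
proof -
  have "\<forall>\<^sub>F s in sequentially. \<forall>i\<in>{..<n}. i \<in> G s \<longleftrightarrow> i \<in> X"
    by (intro eventually_ball_finite ballI G_lim) simp
  then show ?thesis by (simp only: lessThan_iff Ball_def)
qed

text \<open>An infinite set has an element beyond both \<open>2 * e\<close> and the stage from which
  the approximation is settled below \<open>len e\<close>; its first appearance then passes the
  stability test.\<close>

lemma candidate_exists:
  assumes "infinite (W e)"
  shows "\<exists>z. candidate e z"
proof -
  obtain s0 where s0: "\<And>s i. s0 \<le> s \<Longrightarrow> i < len e \<Longrightarrow> i \<in> G s \<longleftrightarrow> i \<in> X"
    using eventually_G_agrees[of "len e"] unfolding eventually_sequentially by blast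
  obtain n where n: "n \<in> W e" "max (2 * e) s0 \<le> n"
    using assms unfolding infinite_nat_iff_unbounded_le by blast
  then have ex: "\<exists>s. n \<in> W_stage e s" using UN_W_stage by blast
  define s where "s = (LEAST s. n \<in> W_stage e s)"
  have s: "n \<in> W_stage e s" unfolding s_def using LeastI_ex[OF ex] .
  then have "s \<noteq> 0" "n < s" by (auto simp: W_stage_def)
  then have "n \<notin> W_stage e (s - 1)" unfolding s_def by (intro not_less_Least) simp
  then have "candidate e (prod_encode (s, n))"
    unfolding candidate_def using s n s0 \<open>n < s\<close> by simp
  then show ?thesis ..
qed

text \<open>The acting pair \<open>(s, n)\<close> has \<open>n < s\<close>, so its code is at most
  that of \<open>(s, s)\<close>. This gives a computable bound on the delay in terms of
  \<open>s\<close> alone.\<close>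

lemma promptly_simple_A: "promptly_simple A"
proof -
  have "\<exists>n s. n \<in> W_stage e s - W_stage e (s - 1) \<and> n \<in> A_stage (Suc (prod_encode (s, s)))"
    if "infinite (W e)" for e
  proof -
    define z where "z = (LEAST z. candidate e z)"
    have acts: "acts e z"
      unfolding acts_def z_def using LeastI_ex[OF candidate_exists[OF that]] not_less_Least by blast
    obtain s n where z: "z = prod_encode (s, n)" by (metis prod.collapse prod_decode_inverse)
    have n: "n \<in> W_stage e s - W_stage e (s - 1)"
      using acts unfolding acts_def candidate_def z by simp
    then have "n < s" by (simp add: W_stage_def)
    then have "z \<le> prod_encode (s, s)"
      unfolding z prod_encode_def triangle_def using \<open>n < s\<close>
      by (simp del: mult_Suc_right) (intro div_le_mono mult_le_mono; simp)
    moreover have "pi2 z = n" "e < Suc n" using acts_le[OF acts] by (simp_all add: z)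
    ultimately have "n \<in> A_stage (Suc (prod_encode (s, s)))"
      unfolding A_stage_def using acts le_imp_less_Suc by blast
    then show ?thesis using n by blast
  qed
  moreover have "computable (\<lambda>s. Suc (prod_encode (s, s)))" by (intro comp_intros)
  ultimately show ?thesis
    unfolding promptly_simple_def
    using ce_A infinite_compl_A A_stage_enumeration by blast
qed

section \<open>The Martin-Loef test built from the actions\<close>

definition test :: "nat \<Rightarrow> (nat \<Rightarrow> bool) set" where
  "test k = (\<Union>e\<in>{k<..}. \<Union>z\<in>{z. acts e z}. hamming_ball (len e) (radius e) (G (pi1 z)))"

lemma uniformly_ce_open_test: "uniformly_ce_open test"
proof -
  \<comment> \<open>The witness \<open>p\<close> codes a requirement together with its acting pair,
    while \<open>w\<close> codes the test index and a string.\<close>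
  define R where "R w p \<longleftrightarrow> pi1 w < pi1 p \<and> acts (pi1 p) (pi2 p) \<and>
    errors (len (pi1 p)) (pi2 w) (G (pi1 (pi2 p))) < radius (pi1 p)" for w p
  have "computable (\<lambda>x. of_bool (R (pi1 x) (pi2 x)))"
    unfolding R_def by (intro comp_intros)
  then have "ce {w. \<exists>p. R w p}" by (rule ce_projection)
  moreover have "test k = (\<Union>\<sigma>\<in>{\<sigma>. prod_encode (k, string_num \<sigma>) \<in> {w. \<exists>p. R w p}}. cylinder \<sigma>)" for k
  proof -
    have "(\<exists>p. R (prod_encode (k, w)) p) \<longleftrightarrow>
      (\<exists>e z. k < e \<and> acts e z \<and> errors (len e) w (G (pi1 z)) < radius e)" for w
      unfolding R_def by (metis fst_conv snd_conv prod_encode_inverse)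
    then show ?thesis unfolding test_def hamming_ball_open by auto
  qed
  ultimately show ?thesis unfolding uniformly_ce_open_def by blast
qed

lemma measure_test: "measure cantor_measure (test k) \<le> (1 / 2) ^ k"
proof -
  \<comment> \<open>Reindexing by \<open>e = Suc k + i\<close> leaves at most one ball in each
    \<open>U i\<close>. Because the indices start strictly above \<open>k\<close>, the bounds sum to
    exactly \<open>(1 / 2) ^ k\<close>.\<close>
  define U where "U i = (\<Union>z\<in>{z. acts (Suc k + i) z}. hamming_ball (len (Suc k + i)) (radius (Suc k + i)) (G (pi1 z)))" for i
  have U: "U i \<in> sets cantor_measure \<and> measure cantor_measure (U i) \<le> (1 / 2) ^ k * (1 / 2) ^ Suc i" for i
  proof (cases "\<exists>z. acts (Suc k + i) z")
    case True
    then obtain z where "{z. acts (Suc k + i) z} = {z}" using acts_unique by blast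
    then have "U i = hamming_ball (len (Suc k + i)) (radius (Suc k + i)) (G (pi1 z))"
      by (simp add: U_def)
    then show ?thesis
      using measure_hamming_ball[of "Suc k + i"] unfolding len_def radius_def by (simp add: power_add mult_ac)
  qed (simp add: U_def)
  have test: "test k = (\<Union>i. U i)"
  proof -
    have "{k<..} = range (\<lambda>i. Suc k + i)" by (auto simp: image_iff dest: less_imp_Suc_add)
    then show ?thesis unfolding test_def U_def by simp
  qed
  have half: "(\<lambda>i. (1 / 2) ^ k * (1 / 2) ^ Suc i) sums ((1 / 2) ^ k * 1 :: real)"
    using power_half_series by (rule sums_mult)
  have summable: "summable (\<lambda>i. measure cantor_measure (U i))"
    using U by (intro summable_comparison_test'[OF sums_summable[OF half]]) auto
  then have "measure cantor_measure (\<Union>i. U i) \<le> (\<Sum>i. measure cantor_measure (U i))"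
    using U by (intro cantor.finite_measure_subadditive_countably) auto
  also have "\<dots> \<le> (1 / 2) ^ k"
    using suminf_le[OF _ summable sums_summable[OF half]] U sums_unique[OF half] by simp
  finally show ?thesis by (simp only: test)
qed

lemma ml_test_test: "ml_test test"
  unfolding ml_test_def using uniformly_ce_open_test measure_test by blast

end

section \<open>Recovering the set from an approximate description\<close>

lemma upper_density_bound:
  assumes "upper_density (sym_diff D X) < ereal (1 / 4)"
  shows "\<forall>\<^sub>F e in sequentially. 2 * hamming (len e) D X < radius e"
proof -
  \<comment> \<open>The gap between \<open>q\<close> and \<open>1 / 4\<close> absorbs the margin:
    along the lengths \<open>len e\<close>, the errors stay below half of \<open>radius e\<close> as
    soon as \<open>(1 / 2) ^ e < 1 - 4 * q\<close>. Half the radius leaves room for two such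
    distances in the triangle inequality.\<close>
  obtain q where q: "upper_density (sym_diff D X) < ereal q" "q < 1 / 4"
    using ereal_dense2[OF assms] by auto
  have "\<forall>\<^sub>F n in sequentially. ereal (partial_density (sym_diff D X) n) < ereal q"
    using q(1) unfolding upper_density_def by (rule Limsup_lessD)
  moreover have "filterlim len at_top sequentially"
  proof -
    have "e \<le> len e" for e
    proof -
      have "e < 2 ^ e" by (rule less_exp)
      also have "\<dots> \<le> (8::nat) ^ e" by (intro power_mono) auto
      finally show ?thesis by (simp add: len_def)
    qed
    then show ?thesis by (intro filterlim_at_top_mono[OF filterlim_ident]) simp
  qed
  ultimately have "\<forall>\<^sub>F e in sequentially. partial_density (sym_diff D X) (len e) < q"
    by (auto dest: filterlim_compose eventually_compose_filterlim)
  moreover have "\<forall>\<^sub>F e in sequentially. (1 / 2) ^ e < 1 - 4 * q"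
    using q(2) by (intro order_tendstoD(2)[OF LIMSEQ_realpow_zero]) auto
  ultimately show ?thesis
  proof eventually_elim
    case (elim e)
    have "real (hamming (len e) D X) < q * (2 * 8 ^ e)"
      using elim(1) unfolding partial_density_def hamming_eq_card len_def by (simp add: divide_less_eq)
    then have "2 * real (hamming (len e) D X) < 4 * q * 8 ^ e" by simp
    also have "\<dots> < (1 - (1 / 2) ^ e) * 8 ^ e" using elim(2) by (intro mult_strict_right_mono) auto
    also have "\<dots> = 8 ^ e - 4 ^ e" by (simp add: algebra_simps power_mult_distrib[symmetric])
    also have "\<dots> = real (radius e)" by (simp add: radius_def of_nat_diff power_mono)
    finally show ?case by linarith
  qed
qed

context computable_approximation
begin

lemma A_turing_le:
  assumes random: "ml_random X" and dense: "upper_density (sym_diff D X) < ereal (1 / 4)"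
  shows "A \<le>\<^sub>T D"
proof -
  obtain k where k: "(\<lambda>n. n \<in> X) \<notin> test k"
    using random ml_test_test unfolding ml_random_def by blast
  obtain e1 where e1: "\<And>e. e1 \<le> e \<Longrightarrow> 2 * hamming (len e) D X < radius e"
    using upper_density_bound[OF dense] unfolding eventually_sequentially by blast
  \<comment> \<open>Beyond \<open>e0\<close> the description is accurate and every ball of an acting
    requirement is part of \<open>test k\<close>.\<close>
  define e0 where "e0 = max e1 (Suc k)"
  \<comment> \<open>This is decidable from \<open>D\<close>. Only \<open>e \<le> n\<close> can
    enumerate \<open>n\<close>, and \<open>n \<le> s\<close> places the stage inside the interval on
    which a candidate guarantees stability.\<close>
  define close where "close n s \<longleftrightarrow> n \<le> s \<and> (\<forall>e<Suc n. e0 \<le> e \<longrightarrow> 2 * hamming (len e) D (G s) < radius e)" for n s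
  have ex_close: "\<exists>s. close n s" for n
  proof -
    have "\<forall>\<^sub>F s in sequentially. \<forall>e\<in>{..<Suc n}. \<forall>i<len e. i \<in> G s \<longleftrightarrow> i \<in> X"
      by (intro eventually_ball_finite ballI eventually_G_agrees) simp
    then have "\<forall>\<^sub>F s in sequentially. n \<le> s \<and> (\<forall>e\<in>{..<Suc n}. \<forall>i<len e. i \<in> G s \<longleftrightarrow> i \<in> X)"
      using eventually_ge_at_top by (rule eventually_conj[rotated])
    then obtain s where s: "n \<le> s" "\<forall>e\<in>{..<Suc n}. \<forall>i<len e. i \<in> G s \<longleftrightarrow> i \<in> X"
      using eventually_happens' sequentially_bot by blast
    then have "hamming (len e) D (G s) = hamming (len e) D X" if "e < Suc n" for e
      using that by (intro hamming_cong) auto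
    then have "close n s" unfolding close_def e0_def using s(1) e1 by simp
    then show ?thesis ..
  qed
  define t where "t n = (LEAST s. close n s)" for n
  have t: "close n (t n)" for n unfolding t_def using LeastI_ex[OF ex_close] .
  \<comment> \<open>\<open>B\<close> collects the numbers enumerated at a stage before
    \<open>t n\<close>; both quantifiers are bounded by functions computable from
    \<open>D\<close>.\<close>
  define B where "B = {n. \<exists>s<t n. \<exists>e<Suc n. acts e (prod_encode (s, n))}"
  have "computable_in D t"
    unfolding t_def by (rule comp_Least[OF _ ex_close], unfold close_def) (intro comp_intros)
  then have "B \<le>\<^sub>T D"
    unfolding B_def turing_le_def mem_Collect_eq by (intro comp_intros)
  moreover have "finite (sym_diff A B)"
  proof (rule finite_subset)
    \<comment> \<open>A number missed by \<open>B\<close> can only come from a requirement below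
      \<open>e0\<close>, and each of these enumerates at most one number.\<close>
    show "sym_diff A B \<subseteq> (\<lambda>e. pi2 (THE z. acts e z)) ` {..<e0}"
    proof
      fix n assume n: "n \<in> sym_diff A B"
      have "B \<subseteq> A"
      proof
        fix m assume "m \<in> B"
        then obtain s e where "acts e (prod_encode (s, m))" unfolding B_def by blast
        moreover have "pi2 (prod_encode (s, m)) = m" by simp
        ultimately show "m \<in> A" unfolding A_def by blast
      qed
      with n have "n \<in> A" "n \<notin> B" by auto
      then obtain e z where z: "acts e z" "pi2 z = n" unfolding A_def by blast
      define s where "s = pi1 z"
      have zs: "z = prod_encode (s, n)" unfolding s_def z(2)[symmetric] by simp
      have e: "e < Suc n" using acts_le[OF z(1)] z(2) by simp
      then have ts: "t n \<le> s" using \<open>n \<notin> B\<close> z(1) unfolding B_def zs by (auto simp: not_less[symmetric])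
      have "e < e0"
      proof (rule ccontr)
        assume "\<not> e < e0"
        then have "2 * hamming (len e) D (G (t n)) < radius e" "2 * hamming (len e) D X < radius e"
          using t[of n] e e1 unfolding close_def e0_def by auto
        \<comment> \<open>The stage \<open>t n\<close> lies between \<open>n\<close> and
          \<open>s\<close>, where the approximation does not change below
          \<open>len e\<close>.\<close>
        moreover have "hamming (len e) D (G (t n)) = hamming (len e) D (G s)"
        proof (rule hamming_cong)
          have "\<forall>u<Suc s. n \<le> u \<longrightarrow> (\<forall>i<len e. i \<in> G u \<longleftrightarrow> i \<in> G s)"
            using z(1) unfolding acts_def candidate_def zs prod_encode_inverse fst_conv snd_conv by blast
          moreover have "n \<le> t n" using t[of n] by (simp add: close_def)
          ultimately show "i \<in> G (t n) \<longleftrightarrow> i \<in> G s" if "i < len e" for i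
            using le_imp_less_Suc[OF ts] that by blast
        qed
        \<comment> \<open>Each distance on the right is less than half the radius, so
          \<open>X\<close> falls into the ball around \<open>G s\<close>.\<close>
        moreover have "hamming (len e) X (G s) \<le> hamming (len e) D X + hamming (len e) D (G s)"
          using hamming_triangle[of "len e" X "G s" D] by (simp add: hamming_commute)
        ultimately have "hamming (len e) X (G s) < radius e" by linarith
        then have "(\<lambda>n. n \<in> X) \<in> test k"
          using z(1) \<open>\<not> e < e0\<close> unfolding test_def hamming_ball_def s_def e0_def by (auto intro!: bexI[of _ e])
        then show False using k by contradiction
      qed
      moreover have "(THE z. acts e z) = z" using z(1) acts_unique by blast
      ultimately show "n \<in> (\<lambda>e. pi2 (THE z. acts e z)) ` {..<e0}" using z(2) by auto
    qed
  qed simp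
  ultimately show ?thesis by (intro turing_le_finite_diff[of A B])
qed

end

section \<open>Coarse descriptions and the operator \<open>E_op\<close>\<close>

lemma upper_density_coarse_description:
  assumes "coarse_description D X"
  shows "upper_density (sym_diff D X) = 0"
proof -
  have "(\<lambda>n. ereal (partial_density (sym_diff D X) n)) \<longlonglongrightarrow> ereal 0"
    using assms unfolding coarse_description_def has_density_def by (intro tendsto_intros)
  then show ?thesis
    unfolding upper_density_def by (simp add: lim_imp_Limsup zero_ereal_def)
qed

lemma coarse_description_refl: "coarse_description Y Y"
  by (simp add: coarse_description_def has_density_def partial_density_def[abs_def])

text \<open>The blocks partition the positive numbers, and a search through the factorials finds the
  block of \<open>x\<close>. The number \<open>0\<close> must be excluded: it lies in no block,
  although the search returns the index \<open>0\<close> for it.\<close>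

lemma mem_E_op_iff: "x \<in> E_op A \<longleftrightarrow> 0 < x \<and> pi1 (LEAST m. x < fact (Suc m)) \<in> A"
proof -
  have ex: "\<exists>m. x < fact (Suc m)" using fact_ge_self[of "Suc x"] by (intro exI[of _ x]) linarith
  have block: "x \<in> block n \<longleftrightarrow> 0 < x \<and> n = (LEAST m. x < fact (Suc m))" for n
  proof
    assume n: "x \<in> block n"
    then have "fact n \<le> x" "x < fact (Suc n)" by (simp_all add: block_def del: fact_Suc)
    moreover have "0 < x" using fact_gt_zero \<open>fact n \<le> x\<close> by (rule less_le_trans)
    moreover have "n \<le> m" if "x < fact (Suc m)" for m
      using fact_mono_nat[of "Suc m" n] that \<open>fact n \<le> x\<close> by (intro leI notI) (simp del: fact_Suc)
    ultimately show "0 < x \<and> n = (LEAST m. x < fact (Suc m))" by (metis Least_equality)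
  next
    assume n: "0 < x \<and> n = (LEAST m. x < fact (Suc m))"
    then have "x < fact (Suc n)" using LeastI_ex[OF ex] by simp
    moreover have "fact n \<le> x"
    proof (cases n)
      case (Suc m)
      then show ?thesis using n not_less_Least[of m "\<lambda>m. x < fact (Suc m)"] by (simp del: fact_Suc)
    qed (use n in simp)
    ultimately show "x \<in> block n" by (simp add: block_def del: fact_Suc)
  qed
  have "n \<in> H_op A \<longleftrightarrow> pi1 n \<in> A" for n
    unfolding H_op_def mem_Collect_eq by (metis fst_conv prod.collapse prod_decode_inverse prod_encode_inverse)
  then show ?thesis unfolding E_op_def I_op_def using block by auto
qed

lemma E_op_turing_le: "E_op A \<le>\<^sub>T D" if "A \<le>\<^sub>T D"
proof -
  have "\<exists>m. x < fact (Suc m)" for x :: nat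
    using fact_ge_self[of "Suc x"] by (intro exI[of _ x]) linarith
  then show ?thesis unfolding turing_le_def mem_E_op_iff
    by (intro comp_intros comp_mem_turing[OF that] comp_Least)
qed

theorem corollary3p10:
  fixes X :: "nat set"
  assumes "X \<le>\<^sub>T zero_jump"
    and "ml_random X"
  shows "(\<exists>A. promptly_simple A \<and>
            (\<forall>D. upper_density (sym_diff D X) < ereal (1 / 4) \<longrightarrow> A \<le>\<^sub>T D)) \<and>
         (\<exists>A. promptly_simple A \<and> A \<in> coarse_class X) \<and>
         (\<exists>A. promptly_simple A \<and> E_op A \<le>\<^sub>n\<^sub>c X)"
proof -
  obtain G where "computable_approximation G X"
    using limit_lemma[OF assms(1)] by blast
  then interpret computable_approximation G X .
  have dense: "A \<le>\<^sub>T D" if "upper_density (sym_diff D X) < ereal (1 / 4)" for D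
    using assms(2) that by (rule A_turing_le)
  then have coarse: "A \<le>\<^sub>T D" if "coarse_description D X" for D
    using upper_density_coarse_description[OF that] by simp
  then have "A \<in> coarse_class X" by (simp add: coarse_class_def)
  \<comment> \<open>The description produced is \<open>E_op A\<close> itself, which is computable
    from \<open>A\<close> and hence from every coarse description of \<open>X\<close>.\<close>
  moreover have "E_op A \<le>\<^sub>n\<^sub>c X"
    unfolding nc_le_def using coarse E_op_turing_le coarse_description_refl by blast
  ultimately show ?thesis using promptly_simple_A dense by blast
qed

end
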